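(* Let $\mathcal S=\{\rho_\theta:\theta\in\Theta\}$ be a quantum statistical model, $\theta\in\Theta$, and $G$ a weight matrix. For each $n$ let $M^n$ be an estimator for $\mathcal S^{\otimes n}$ (a POVM on $\mathcal H^{\otimes n}$ with outcomes $\hat\theta\in\mathbb{R}^d$, with finite second moments and with $\theta\mapsto E_\theta(M^n)$ differentiable) such that the sequence $\{M^n\}$ is asymptotically unbiased at $\theta$. Then $$\liminf_{n\to\infty} n\,\mathrm{tr}\,G\,V_\theta(M^n)\;\ge\;C^H_\theta(G).$$ Consequently the quantum Cramér–Rao bound satisfies $C_\theta(G)\ge C^H_\theta(G)$.
   Context: A quantum statistical model is a family $\{\rho_\theta\}$ of strictly positive density matrices on a finite-dimensional Hilbert space $\mathcal H$ depending smoothly on $\theta$ in an open set $\Theta\subset\mathbb{R}^d$; $\partial_k=\partial/\partial\theta^k$. A weight matrix is a real symmetric positive definite $d\times d$ matrix. For an estimator $M^n$ of $\mathcal S^{\otimes n}=\{\rho_\theta^{\otimes n}\}$: $E^j_\theta(M^n)=\int\hat\theta^j\,\mathrm{Tr}\,M^n(d\hat\theta)\rho_\theta^{\otimes n}$, $A^j_{\theta;k}(M^n)=\partial_kE^j_\theta(M^n)$, and MSE matrix $V_\theta^{k,j}(M^n)=\int(\hat\theta^k-\theta^k)(\hat\theta^j-\theta^j)\,\mathrm{Tr}\,M^n(d\hat\theta)\rho_\theta^{\otimes n}$. The sequence is asymptotically unbiased at $\theta$ if $E^j_\theta(M^n)\to\theta^j$ and $A^j_{\theta;k}(M^n)\to\delta^j_k$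 as $n\to\infty$. The quantum Cramér–Rao bound $C_\theta(G)$ is the infimum of $\liminf_n n\,\mathrm{tr}\,G V_\theta(M^n)$ over asymptotically unbiased sequences. For a complex matrix $W$: $\mathrm{Re}\,W=(W+\bar W)/2$, $\mathrm{Im}\,W=(W-\bar W)/(2i)$, $|A|=(A^*A)^{1/2}$. For a $d$-tuple $\vec X$ of Hermitian matrices on $\mathcal H$, $Z^{k,j}_\theta(\vec X)=\mathrm{Tr}\,\rho_\theta X^kX^j$, $C_\theta(G,\vec X)=\mathrm{tr}\sqrt G\,\mathrm{Re}Z_\theta(\vec X)\sqrt G+\mathrm{tr}|\sqrt G\,\mathrm{Im}Z_\theta(\vec X)\sqrt G|$, and the Holevo bound is $C^H_\theta(G)=\min\{C_\theta(G,\vec X):\mathrm{Tr}\,(\partial_k\rho_\theta)X^j=\delta^j_k\ \forall j,k\}$. *)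

theory Defs
  imports "HOL-Analysis.Analysis" "HOL-Probability.Probability"
begin

text \<open>Operators on C^m are represented as functions nat => nat => complex; only the
  entries with both indices below m are relevant (all operations below only look at them).
  We need variable dimension because the Hilbert space of S^{tensor n} has dimension N^n.\<close>

type_synonym cmat = "nat \<Rightarrow> nat \<Rightarrow> complex"

definition mmul :: "nat \<Rightarrow> cmat \<Rightarrow> cmat \<Rightarrow> cmat" where
  "mmul m A B = (\<lambda>i j. \<Sum>k<m. A i k * B k j)"

definition mtr :: "nat \<Rightarrow> cmat \<Rightarrow> complex" where
  "mtr m A = (\<Sum>i<m. A i i)"

definition mid :: cmat where
  "mid = (\<lambda>i j. if i = j then 1 else 0)"

definition meq :: "nat \<Rightarrow> cmat \<Rightarrow> cmat \<Rightarrow> bool" where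
  "meq m A B \<longleftrightarrow> (\<forall>i<m. \<forall>j<m. A i j = B i j)"

definition hermitian :: "nat \<Rightarrow> cmat \<Rightarrow> bool" where
  "hermitian m A \<longleftrightarrow> (\<forall>i<m. \<forall>j<m. A j i = cnj (A i j))"

definition qform :: "nat \<Rightarrow> cmat \<Rightarrow> (nat \<Rightarrow> complex) \<Rightarrow> complex" where
  "qform m A v = (\<Sum>i<m. \<Sum>j<m. cnj (v i) * A i j * v j)"

definition psd :: "nat \<Rightarrow> cmat \<Rightarrow> bool" where
  "psd m A \<longleftrightarrow> hermitian m A \<and> (\<forall>v. 0 \<le> Re (qform m A v))"

definition pos_def :: "nat \<Rightarrow> cmat \<Rightarrow> bool" where
  "pos_def m A \<longleftrightarrow> hermitian m A \<and> (\<forall>v. (\<exists>i<m. v i \<noteq> 0) \<longrightarrow> 0 < Re (qform m A v))"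

text \<open>Kronecker product A (x) B where B has dimension nB (index (i,k) |-> i*nB + k).\<close>
definition kron :: "nat \<Rightarrow> cmat \<Rightarrow> cmat \<Rightarrow> cmat" where
  "kron nB A B = (\<lambda>i j. A (i div nB) (j div nB) * B (i mod nB) (j mod nB))"

primrec tpow :: "nat \<Rightarrow> nat \<Rightarrow> cmat \<Rightarrow> cmat" where
  "tpow N 0 A = (\<lambda>i j. 1)"
| "tpow N (Suc n) A = kron N (tpow N n A) A"

definition strict_density :: "nat \<Rightarrow> cmat \<Rightarrow> bool" where
  "strict_density N A \<longleftrightarrow> pos_def N A \<and> mtr N A = 1"

text \<open>C^m on a set (for open sets): all iterated directional (equivalently partial)
  derivatives up to order m exist and are continuous.\<close>
fun cont_diff_on :: "nat \<Rightarrow> 'a::euclidean_space set \<Rightarrow> ('a \<Rightarrow> 'b::real_normed_vector) \<Rightarrow> bool" where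
  "cont_diff_on 0 S f \<longleftrightarrow> continuous_on S f"
| "cont_diff_on (Suc m) S f \<longleftrightarrow> f differentiable_on S \<and> continuous_on S f \<and>
     (\<forall>v. cont_diff_on m S (\<lambda>x. frechet_derivative f (at x) v))"

definition smooth_on :: "'a::euclidean_space set \<Rightarrow> ('a \<Rightarrow> 'b::real_normed_vector) \<Rightarrow> bool" where
  "smooth_on S f \<longleftrightarrow> (\<forall>m. cont_diff_on m S f)"

definition pderiv_at :: "'d::finite \<Rightarrow> (real^'d \<Rightarrow> 'b::real_normed_vector) \<Rightarrow> real^'d \<Rightarrow> 'b" where
  "pderiv_at k f t = frechet_derivative f (at t) (axis k 1)"

definition qmodel :: "nat \<Rightarrow> (real^'d::finite) set \<Rightarrow> (real^'d \<Rightarrow> cmat) \<Rightarrow> bool" where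
  "qmodel N \<Theta> \<rho> \<longleftrightarrow> 0 < N \<and> open \<Theta> \<and>
     (\<forall>t\<in>\<Theta>. strict_density N (\<rho> t)) \<and>
     (\<forall>i<N. \<forall>j<N. smooth_on \<Theta> (\<lambda>t. \<rho> t i j))"

definition drho :: "(real^'d::finite \<Rightarrow> cmat) \<Rightarrow> real^'d \<Rightarrow> 'd \<Rightarrow> cmat" where
  "drho \<rho> t k = (\<lambda>i j. pderiv_at k (\<lambda>s. \<rho> s i j) t)"

definition weight_matrix :: "real^'d^'d \<Rightarrow> bool" where
  "weight_matrix G \<longleftrightarrow> transpose G = G \<and> (\<forall>x. x \<noteq> 0 \<longrightarrow> 0 < x \<bullet> (G *v x))"

definition psd_real :: "real^'d^'d \<Rightarrow> bool" where
  "psd_real B \<longleftrightarrow> transpose B = B \<and> (\<forall>x. 0 \<le> x \<bullet> (B *v x))"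

definition msqrt :: "real^'d^'d \<Rightarrow> real^'d^'d" where
  "msqrt A = (THE B. psd_real B \<and> B ** B = A)"

definition trace_abs :: "real^'d^'d \<Rightarrow> real" where
  "trace_abs A = trace (msqrt (transpose A ** A))"

definition ReM :: "complex^'d^'d \<Rightarrow> real^'d^'d" where
  "ReM W = (\<chi> i j. Re (W $ i $ j))"

definition ImM :: "complex^'d^'d \<Rightarrow> real^'d^'d" where
  "ImM W = (\<chi> i j. Im (W $ i $ j))"

definition Zmat :: "nat \<Rightarrow> cmat \<Rightarrow> ('d::finite \<Rightarrow> cmat) \<Rightarrow> complex^'d^'d" where
  "Zmat N \<sigma> X = (\<chi> k j. mtr N (mmul N \<sigma> (mmul N (X k) (X j))))"

definition CGX :: "nat \<Rightarrow> cmat \<Rightarrow> real^'d::finite^'d \<Rightarrow> ('d \<Rightarrow> cmat) \<Rightarrow> real" where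
  "CGX N \<sigma> G X =
     trace (msqrt G ** ReM (Zmat N \<sigma> X) ** msqrt G)
     + trace_abs (msqrt G ** ImM (Zmat N \<sigma> X) ** msqrt G)"

definition holevo_bound :: "nat \<Rightarrow> (real^'d::finite \<Rightarrow> cmat) \<Rightarrow> real^'d \<Rightarrow> real^'d^'d \<Rightarrow> real" where
  "holevo_bound N \<rho> t G = Inf {CGX N (\<rho> t) G X | X.
      (\<forall>k. hermitian N (X k)) \<and>
      (\<forall>k j. mtr N (mmul N (drho \<rho> t k) (X j)) = (if j = k then 1 else 0))}"

definition is_povm :: "nat \<Rightarrow> ((real^'d::finite) set \<Rightarrow> cmat) \<Rightarrow> bool" where
  "is_povm m M \<longleftrightarrow> (\<forall>A\<in>sets borel. psd m (M A)) \<and> meq m (M UNIV) mid \<and>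
     (\<forall>v. measure_space UNIV (sets borel) (\<lambda>A. ennreal (Re (qform m (M A) v))))"

definition outcome :: "nat \<Rightarrow> ((real^'d::finite) set \<Rightarrow> cmat) \<Rightarrow> cmat \<Rightarrow> (real^'d) measure" where
  "outcome m M \<sigma> = measure_of UNIV (sets borel) (\<lambda>A. ennreal (Re (mtr m (mmul m (M A) \<sigma>))))"

definition expect :: "nat \<Rightarrow> ((real^'d::finite) set \<Rightarrow> cmat) \<Rightarrow> cmat \<Rightarrow> real^'d" where
  "expect m M \<sigma> = (\<chi> j. \<integral>x. x $ j \<partial>outcome m M \<sigma>)"

definition mse :: "nat \<Rightarrow> ((real^'d::finite) set \<Rightarrow> cmat) \<Rightarrow> cmat \<Rightarrow> real^'d \<Rightarrow> real^'d^'d" where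
  "mse m M \<sigma> t = (\<chi> k j. \<integral>x. (x $ k - t $ k) * (x $ j - t $ j) \<partial>outcome m M \<sigma>)"

definition E_n :: "nat \<Rightarrow> (real^'d::finite \<Rightarrow> cmat) \<Rightarrow> (nat \<Rightarrow> (real^'d) set \<Rightarrow> cmat) \<Rightarrow> nat \<Rightarrow> real^'d \<Rightarrow> real^'d" where
  "E_n N \<rho> Ms n t = expect (N ^ n) (Ms n) (tpow N n (\<rho> t))"

definition A_n :: "nat \<Rightarrow> (real^'d::finite \<Rightarrow> cmat) \<Rightarrow> (nat \<Rightarrow> (real^'d) set \<Rightarrow> cmat) \<Rightarrow> nat \<Rightarrow> real^'d \<Rightarrow> real^'d^'d" where
  "A_n N \<rho> Ms n t = (\<chi> j k. pderiv_at k (\<lambda>s. E_n N \<rho> Ms n s $ j) t)"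

definition V_n :: "nat \<Rightarrow> (real^'d::finite \<Rightarrow> cmat) \<Rightarrow> (nat \<Rightarrow> (real^'d) set \<Rightarrow> cmat) \<Rightarrow> nat \<Rightarrow> real^'d \<Rightarrow> real^'d^'d" where
  "V_n N \<rho> Ms n t = mse (N ^ n) (Ms n) (tpow N n (\<rho> t)) t"

definition estimator_seq :: "nat \<Rightarrow> (real^'d::finite) set \<Rightarrow> (real^'d \<Rightarrow> cmat) \<Rightarrow> (nat \<Rightarrow> (real^'d) set \<Rightarrow> cmat) \<Rightarrow> bool" where
  "estimator_seq N \<Theta> \<rho> Ms \<longleftrightarrow> (\<forall>n.
      is_povm (N ^ n) (Ms n) \<and>
      (\<forall>t\<in>\<Theta>. \<forall>j. integrable (outcome (N ^ n) (Ms n) (tpow N n (\<rho> t))) (\<lambda>x. (x $ j)\<^sup>2)) \<and>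
      (E_n N \<rho> Ms n) differentiable_on \<Theta>)"

definition asym_unbiased :: "nat \<Rightarrow> (real^'d::finite \<Rightarrow> cmat) \<Rightarrow> real^'d \<Rightarrow> (nat \<Rightarrow> (real^'d) set \<Rightarrow> cmat) \<Rightarrow> bool" where
  "asym_unbiased N \<rho> t Ms \<longleftrightarrow>
     (\<lambda>n. E_n N \<rho> Ms n t) \<longlonglongrightarrow> t \<and> (\<lambda>n. A_n N \<rho> Ms n t) \<longlonglongrightarrow> mat 1"

definition qcr_bound :: "nat \<Rightarrow> (real^'d::finite) set \<Rightarrow> (real^'d \<Rightarrow> cmat) \<Rightarrow> real^'d \<Rightarrow> real^'d^'d \<Rightarrow> ereal" where
  "qcr_bound N \<Theta> \<rho> t G = Inf {liminf (\<lambda>n. ereal (real n * trace (G ** V_n N \<rho> Ms n t))) | Ms.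
      estimator_seq N \<Theta> \<rho> Ms \<and> asym_unbiased N \<rho> t Ms}"

end

theory Submission
  imports Defs
begin

text \<open>
  For an estimator \<open>M\<close> on \<open>n\<close> copies put \<open>X\<^sub>j = \<integral>(x\<^sub>j - \<theta>\<^sub>j) M(dx)\<close>. Positivity of
  \<open>\<integral>(\<phi>(x) - P)\<^sup>* M(dx) (\<phi>(x) - P)\<close> in the state \<open>\<rho>\<^sup>\<otimes>\<^sup>n\<close> bounds the mean square error from below by
  correlations of the \<open>X\<^sub>j\<close> with an arbitrary operator \<open>P\<close>. Choosing \<open>P\<close> as a normalised sum over the sites
  of a single-copy operator replaces the \<open>X\<^sub>j\<close> by the sums \<open>Y\<^sub>j\<close> of their conditional expectations on the
  single sites, and gives \<open>Z(Y) \<le> n V\<close> as complex matrices. The \<open>Y\<^sub>j\<close> reproduce the derivative matrix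
  \<open>A\<^sub>n\<close> of the mean, so \<open>A\<^sub>n\<^sup>-\<^sup>1 Y\<close> is admissible for the Holevo bound, and \<open>A\<^sub>n\<close> tends to
  the identity.
\<close>

subsection \<open>Real symmetric matrices\<close>

text \<open>The coefficients of the test functions must be complex. Real ones see only the real part
  of \<open>Z(Y)\<close>, while the summand \<open>tr |Im Z|\<close> of the Holevo functional is
  recovered by testing at \<open>a + i b\<close>: since the mean square error matrix is real, all of
  \<open>Im Z\<close> is then bounded by the excess \<open>n V - Re Z\<close>. Two analytic
  obstacles shape the middle of the proof. An estimator is only a matrix-valued set function, so
  operator integrals are formed through a matrix density with respect to its trace; this density has
  trace one and hence bounded entries. Moreover, the second moments are finite under the outcome
  law, whereas the operators \<open>X_j\<close> are integrals against the trace measure. Strict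
  positivity of the state dominates the trace measure by a multiple of the outcome law and so
  transfers integrability. Once the \<open>X_j\<close> exist, the mean is a trace of the state
  against fixed operators, and differentiating it amounts to differentiating the tensor power of the
  state.\<close>

lemma inner_matrix_transpose:
  fixes A :: "real^'d^'d"
  shows "x \<bullet> (A *v y) = (transpose A *v x) \<bullet> y"
  by (simp add: transpose_matrix_vector dot_lmul_matrix)

definition orthonormal :: "'a::euclidean_space set \<Rightarrow> bool" where
  "orthonormal B \<longleftrightarrow> pairwise orthogonal B \<and> (\<forall>b\<in>B. norm b = 1)"

lemma orthonormal_independent: "orthonormal B \<Longrightarrow> independent B"
  unfolding orthonormal_def using pairwise_orthogonal_independent by fastforce

lemma orthonormal_finite: "orthonormal B \<Longrightarrow> finite B"
  using orthonormal_independent independent_imp_finite by blast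

lemma orthonormal_card: "orthonormal (B::'a::euclidean_space set) \<Longrightarrow> card B \<le> DIM('a)"
  using orthonormal_independent independent_bound by blast

lemma orthonormal_inner:
  assumes "orthonormal B" "b \<in> B" "c \<in> B"
  shows "b \<bullet> c = (if b = c then 1 else 0)"
  using assms unfolding orthonormal_def pairwise_def orthogonal_def
  by (auto simp: dot_square_norm)

text \<open>A maximiser of the Rayleigh quotient on an invariant subspace is an eigenvector.\<close>
lemma symmetric_eigenvector_in_invariant_subspace:
  fixes A :: "real^'d^'d"
  assumes sym: "transpose A = A" and W: "subspace W" "W \<noteq> {0}"
    and inv: "\<And>x. x \<in> W \<Longrightarrow> A *v x \<in> W"
  obtains x where "x \<in> W" "norm x = 1" "A *v x = (x \<bullet> (A *v x)) *\<^sub>R x"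
proof -
  obtain w0 where w0: "w0 \<in> W" "w0 \<noteq> 0"
    using W subspace_0 by blast
  let ?K = "W \<inter> sphere 0 1"
  have "compact ?K"
    using closed_subspace[OF W(1)] by (simp add: closed_Int_compact)
  moreover have "inverse (norm w0) *\<^sub>R w0 \<in> ?K"
    using w0 W(1) by (auto simp: subspace_scale)
  moreover have "continuous_on ?K (\<lambda>x. x \<bullet> (A *v x))"
    by (intro continuous_intros)
  ultimately obtain x where x: "x \<in> ?K" and mx: "\<And>y. y \<in> ?K \<Longrightarrow> y \<bullet> (A *v y) \<le> x \<bullet> (A *v x)"
    using continuous_attains_sup[of ?K "\<lambda>x. x \<bullet> (A *v x)"] by blast
  define l where "l = x \<bullet> (A *v x)"
  have xW: "x \<in> W" and xx: "x \<bullet> x = 1"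
    using x by (auto simp: dot_square_norm)
  have le: "w \<bullet> (A *v w) \<le> l * (w \<bullet> w)" if "w \<in> W" for w
  proof (cases "w = 0")
    case False
    have "inverse (norm w) *\<^sub>R w \<in> ?K"
      using that False W(1) by (auto simp: subspace_scale)
    from mx[OF this] have "inverse (norm w) * (inverse (norm w) * (w \<bullet> (A *v w))) \<le> l"
      by (simp add: l_def matrix_vector_mult_scaleR)
    then have "(w \<bullet> (A *v w)) / (norm w)^2 \<le> l"
      by (simp add: field_simps power2_eq_square)
    then show ?thesis using False
      by (simp add: dot_square_norm field_simps)
  qed simp
  define y where "y = A *v x - l *\<^sub>R x"
  have yW: "y \<in> W"
    unfolding y_def using inv[OF xW] xW W(1) by (simp add: subspace_diff subspace_scale)
  have xy: "x \<bullet> y = 0"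
    by (simp add: y_def inner_diff_right xx l_def)
  have Ax: "A *v x = y + l *\<^sub>R x" by (simp add: y_def)
  have xAy: "x \<bullet> (A *v y) = y \<bullet> y"
    using inner_matrix_transpose[of x A y] sym Ax xy
    by (simp add: inner_add_left inner_add_right inner_commute[of y x])
  have yAx: "y \<bullet> (A *v x) = y \<bullet> y"
    using Ax xy by (simp add: inner_add_right inner_commute)
  define c where "c = l * (y \<bullet> y) - y \<bullet> (A *v y)"
  \<comment> \<open>Maximality tested at \<open>x + s *\<^sub>R y\<close>, with \<open>y\<close> the
    residual of the eigenvalue equation: the left side is linear in \<open>s\<close> and the right
    side quadratic, so small positive \<open>s\<close> forces \<open>y = 0\<close>.\<close>
  have q: "2 * s * (y \<bullet> y) \<le> s^2 * c" for s
  proof -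
    have "x + s *\<^sub>R y \<in> W"
      using xW yW W(1) by (simp add: subspace_add subspace_scale)
    from le[OF this] show ?thesis
      using xx xy xAy yAx l_def
      by (simp add: c_def matrix_vector_right_distrib matrix_vector_mult_scaleR inner_add_left
          inner_add_right inner_commute power2_eq_square algebra_simps)
  qed
  have "y \<bullet> y = 0"
  proof (rule ccontr)
    assume "y \<bullet> y \<noteq> 0"
    then have p: "y \<bullet> y > 0" by simp
    have c: "2 * (y \<bullet> y) \<le> c" using q[of 1] by simp
    then have cp: "c > 0" using p by linarith
    have "2 * ((y \<bullet> y) / c) * (y \<bullet> y) \<le> ((y \<bullet> y) / c)^2 * c" by (rule q)
    also have "\<dots> = ((y \<bullet> y) / c) * (y \<bullet> y)" using cp by (simp add: power2_eq_square)
    finally have "(y \<bullet> y) / c * (y \<bullet> y) \<le> 0" by simp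
    moreover have "(y \<bullet> y) / c * (y \<bullet> y) > 0" using p cp by simp
    ultimately show False by linarith
  qed
  then have "A *v x = l *\<^sub>R x" by (simp add: y_def)
  then show thesis using that[of x] xW x by (simp add: l_def)
qed

definition eigenbasis :: "real^'d^'d \<Rightarrow> (real^'d) set \<Rightarrow> bool" where
  "eigenbasis A B \<longleftrightarrow> orthonormal B \<and> span B = UNIV \<and>
     (\<forall>b\<in>B. \<exists>l. A *v b = l *\<^sub>R b)"

lemma eigenbasis_eigenvalue:
  assumes "eigenbasis A B" "b \<in> B"
  shows "A *v b = (b \<bullet> (A *v b)) *\<^sub>R b"
proof -
  obtain l where "A *v b = l *\<^sub>R b" using assms by (auto simp: eigenbasis_def)
  moreover have "b \<bullet> b = 1" using assms orthonormal_inner[of B b b] by (simp add: eigenbasis_def)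
  ultimately show ?thesis by simp
qed

text \<open>An orthonormal set of eigenvectors of greatest cardinality must span: its orthogonal
  complement is invariant, and if it were nonzero it would contain one more unit
  eigenvector.\<close>

theorem spectral_theorem_real:
  fixes A :: "real^'d^'d"
  assumes sym: "transpose A = A"
  obtains B where "eigenbasis A B"
proof -
  let ?P = "\<lambda>B. orthonormal B \<and> (\<forall>b\<in>B. \<exists>l. A *v b = l *\<^sub>R b)"
  have "?P {}" by (simp add: orthonormal_def)
  moreover have "\<forall>B. ?P B \<longrightarrow> card B \<le> DIM(real^'d)" using orthonormal_card by blast
  ultimately obtain B where B: "?P B" and mx: "\<And>C. ?P C \<Longrightarrow> card C \<le> card B"
    using ex_has_greatest_nat[of ?P "{}" card "Suc DIM(real^'d)"] by (auto simp: less_Suc_eq_le)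
  define W where "W = {x. \<forall>b\<in>B. orthogonal b x}"
  have W: "subspace W"
    unfolding W_def by (rule subspace_orthogonal_to_vectors)
  have inv: "A *v x \<in> W" if "x \<in> W" for x
    unfolding W_def orthogonal_def
  proof clarify
    fix b assume b: "b \<in> B"
    have "b \<bullet> (A *v x) = (A *v b) \<bullet> x" using inner_matrix_transpose[of b A x] sym by simp
    also obtain l where "A *v b = l *\<^sub>R b" using B b by blast
    also have "(l *\<^sub>R b) \<bullet> x = 0" using that b by (simp add: W_def orthogonal_def)
    finally show "b \<bullet> (A *v x) = 0" .
  qed
  have W0: "W = {0}"
  proof (rule ccontr)
    assume "W \<noteq> {0}"
    then obtain x where x: "x \<in> W" "norm x = 1" "A *v x = (x \<bullet> (A *v x)) *\<^sub>R x"
      using symmetric_eigenvector_in_invariant_subspace[OF sym W _ inv] by blast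
    have xB: "x \<notin> B" using x by (auto simp: W_def orthogonal_def)
    have "orthonormal (insert x B)"
      using B x(1,2) unfolding orthonormal_def
      by (auto simp: pairwise_insert W_def orthogonal_commute)
    moreover have "\<exists>l. A *v x = l *\<^sub>R x" using x(3) by blast
    ultimately have "?P (insert x B)" using B by blast
    from mx[OF this] show False
      using xB B orthonormal_finite[of B] by simp
  qed
  have "span B = UNIV"
  proof (rule ccontr)
    assume "span B \<noteq> UNIV"
    then have "span B \<subset> UNIV" by blast
    then obtain z where z: "z \<noteq> 0" "\<And>y. y \<in> span B \<Longrightarrow> orthogonal z y"
      using span_not_UNIV_orthogonal[of B] unfolding orthogonal_def by blast
    then have "z \<in> W" using span_base unfolding W_def by (auto simp: orthogonal_commute)
    then show False using W0 z by blast
  qed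
  then show thesis using that B by (auto simp: eigenbasis_def)
qed

lemma orthonormal_expand:
  assumes "orthonormal B" "span B = UNIV"
  shows "(\<Sum>b\<in>B. (x \<bullet> b) *\<^sub>R b) = x"
  by (rule orthonormal_basis_expand) (use assms orthonormal_finite in \<open>auto simp: orthonormal_def\<close>)

lemma trace_orthonormal_basis:
  fixes A :: "real^'d^'d"
  assumes "orthonormal B" "span B = UNIV"
  shows "trace A = (\<Sum>b\<in>B. b \<bullet> (A *v b))"
proof -
  \<comment> \<open>Completeness relation of the basis, read off from the expansion of the
    coordinate vectors.\<close>
  have p: "(\<Sum>b\<in>B. b $ i * b $ j) = (if i = j then 1 else 0)" for i j :: 'd
  proof -
    have "(\<Sum>b\<in>B. ((axis i 1 :: real^'d) \<bullet> b) *\<^sub>R b) $ j = axis i 1 $ j"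
      using orthonormal_expand[OF assms, of "axis i 1"] by simp
    then have "(\<Sum>b\<in>B. b $ i * b $ j) = (axis i 1 :: real^'d) $ j" by (simp add: inner_axis')
    then show ?thesis by (auto simp: axis_def)
  qed
  have "(\<Sum>b\<in>B. b \<bullet> (A *v b)) = (\<Sum>b\<in>B. \<Sum>i\<in>UNIV. \<Sum>j\<in>UNIV. A$i$j * (b$i * b$j))"
    by (simp add: inner_vec_def matrix_vector_mult_def sum_distrib_left algebra_simps)
  also have "\<dots> = (\<Sum>i\<in>UNIV. \<Sum>j\<in>UNIV. A$i$j * (\<Sum>b\<in>B. b$i * b$j))"
    by (subst sum.swap, rule sum.cong[OF refl], subst sum.swap) (simp add: sum_distrib_left)
  also have "\<dots> = trace A"
    by (simp add: p trace_def if_distrib[of "\<lambda>x. _ * x"] cong: if_cong)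
  finally show ?thesis by simp
qed

lemma matrix_eq_on_spanning_set:
  fixes P Q :: "real^'d^'d"
  assumes "span B = UNIV" "\<And>b. b \<in> B \<Longrightarrow> P *v b = Q *v b"
  shows "P = Q"
proof -
  have "P *v x = Q *v x" for x
    by (rule linear_eq_on_span[of "(*v) P" "(*v) Q" B x]) (use assms in auto)
  then show ?thesis by (simp add: matrix_eq)
qed

section \<open>Square roots and the trace norm\<close>

lemma psd_real_sqrt_ex:
  fixes A :: "real^'d^'d"
  assumes A: "psd_real A" and B: "eigenbasis A B"
  obtains P where "psd_real P" "P ** P = A" "\<And>b. b \<in> B \<Longrightarrow> P *v b = sqrt (b \<bullet> (A *v b)) *\<^sub>R b"
proof -
  have on: "orthonormal B" and sp: "span B = UNIV"
    using B by (auto simp: eigenbasis_def)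
  have fin: "finite B" using on orthonormal_finite by blast
  define s where "s b = sqrt (b \<bullet> (A *v b))" for b
  have s2: "s b * s b = b \<bullet> (A *v b)" for b using A by (simp add: s_def psd_real_def)
  have s0: "s b \<ge> 0" for b using A by (simp add: s_def psd_real_def)
  \<comment> \<open>Spectral formula: rank one projections onto the \<open>b\<close>, weighted by
    the roots of the eigenvalues.\<close>
  define P :: "real^'d^'d" where "P = (\<chi> i j. \<Sum>b\<in>B. s b * (b$i * b$j))"
  have Px: "P *v x = (\<Sum>b\<in>B. (s b * (b \<bullet> x)) *\<^sub>R b)" for x
  proof (rule vec_eq_iff[THEN iffD2], rule allI)
    fix i
    have "(P *v x) $ i = (\<Sum>j\<in>UNIV. \<Sum>b\<in>B. s b * (b$i * b$j) * x $ j)"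
      by (simp add: P_def matrix_vector_mult_def sum_distrib_right)
    also have "\<dots> = (\<Sum>b\<in>B. \<Sum>j\<in>UNIV. s b * (b$i * b$j) * x $ j)" by (rule sum.swap)
    also have "\<dots> = (\<Sum>b\<in>B. (s b * (b \<bullet> x)) *\<^sub>R b) $ i"
      by (simp add: inner_vec_def sum_distrib_left sum_distrib_right mult_ac)
    finally show "(P *v x) $ i = (\<Sum>b\<in>B. (s b * (b \<bullet> x)) *\<^sub>R b) $ i" .
  qed
  have Pb: "P *v b = s b *\<^sub>R b" if "b \<in> B" for b
  proof -
    have "P *v b = (\<Sum>c\<in>B. if c = b then s b *\<^sub>R b else 0)"
      unfolding Px by (rule sum.cong) (auto simp: orthonormal_inner[OF on _ that])
    then show ?thesis using that fin by simp
  qed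
  have "transpose P = P"
    by (simp add: P_def transpose_def mult.commute)
  moreover have "0 \<le> x \<bullet> (P *v x)" for x
    unfolding Px inner_sum_right
    by (rule sum_nonneg) (simp add: inner_commute[of x] mult.assoc s0)
  ultimately have "psd_real P" by (simp add: psd_real_def)
  moreover have "P ** P = A"
  proof (rule matrix_eq_on_spanning_set[OF sp])
    fix b assume b: "b \<in> B"
    have "(P ** P) *v b = (b \<bullet> (A *v b)) *\<^sub>R b"
      by (simp add: Pb[OF b] s2 matrix_vector_mul_assoc[symmetric] matrix_vector_mult_scaleR)
    then show "(P ** P) *v b = A *v b" using eigenbasis_eigenvalue[OF B b] by (rule trans[OF _ sym])
  qed
  ultimately show thesis using Pb by (intro that) (simp_all add: s_def)
qed

text \<open>Factor \<open>P^2 - l\<close> as \<open>(P + sqrt l) (P - sqrt l)\<close>: the vector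
  \<open>(P - sqrt l) v\<close> is mapped by \<open>P\<close> to \<open>- sqrt l\<close> times
  itself, which positivity forbids unless it vanishes or \<open>l = 0\<close>. In the latter case
  the squared norm of \<open>P v\<close> is \<open>v \<bullet> (P (P v)) = 0\<close>.\<close>

lemma psd_real_sqrt_eigenvector:
  fixes P :: "real^'d^'d"
  assumes P: "psd_real P" and v: "(P ** P) *v v = l *\<^sub>R v" and l: "0 \<le> l"
  shows "P *v v = sqrt l *\<^sub>R v"
proof -
  have PP: "P *v (P *v v) = l *\<^sub>R v" using v by (simp add: matrix_vector_mul_assoc)
  have sym: "transpose P = P" using P by (simp add: psd_real_def)
  define w where "w = P *v v - sqrt l *\<^sub>R v"
  have Pw: "P *v w = - sqrt l *\<^sub>R w"
    using PP l by (simp add: w_def matrix_vector_mult_diff_distrib matrix_vector_mult_scaleR algebra_simps)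
  have "0 \<le> w \<bullet> (P *v w)" using P by (simp add: psd_real_def)
  then have "sqrt l * (w \<bullet> w) \<le> 0" by (simp add: Pw)
  then have "l = 0 \<or> w = 0"
    using l by (metis inner_ge_zero inner_eq_zero_iff mult_eq_0_iff mult_nonneg_nonneg
        order_antisym real_sqrt_eq_zero_cancel_iff real_sqrt_ge_zero)
  moreover have "P *v v = 0" if "l = 0"
  proof -
    have "(P *v v) \<bullet> (P *v v) = v \<bullet> (P *v (P *v v))"
      using inner_matrix_transpose[of v P "P *v v"] sym by simp
    then show ?thesis using PP that by simp
  qed
  ultimately show ?thesis by (auto simp: w_def)
qed

text \<open>\<open>msqrt\<close> is a definite description, so uniqueness has to be shown along with
  existence: every positive square root acts on each eigenvector of \<open>A\<close> by the root of
  the eigenvalue, and eigenvectors span.\<close>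

lemma msqrt_works:
  fixes A :: "real^'d^'d"
  assumes A: "psd_real A"
  shows psd_real_msqrt: "psd_real (msqrt A)" and msqrt_mult_self: "msqrt A ** msqrt A = A"
    and msqrt_eigenbasis: "\<And>B b. eigenbasis A B \<Longrightarrow> b \<in> B \<Longrightarrow> msqrt A *v b = sqrt (b \<bullet> (A *v b)) *\<^sub>R b"
proof -
  obtain B where B: "eigenbasis A B"
    using spectral_theorem_real A unfolding psd_real_def by blast
  obtain P where P: "psd_real P" "P ** P = A"
    using psd_real_sqrt_ex[OF A B] by blast
  have act: "Q *v b = sqrt (b \<bullet> (A *v b)) *\<^sub>R b"
    if "psd_real Q" "Q ** Q = A" "eigenbasis A C" "b \<in> C" for Q C b
  proof (rule psd_real_sqrt_eigenvector[OF that(1)])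
    show "(Q ** Q) *v b = (b \<bullet> (A *v b)) *\<^sub>R b"
      unfolding that(2) by (rule eigenbasis_eigenvalue[OF that(3,4)])
    show "0 \<le> b \<bullet> (A *v b)" using A by (simp add: psd_real_def)
  qed
  have sp: "span B = UNIV" using B by (simp add: eigenbasis_def)
  have "Q = P" if "psd_real Q" "Q ** Q = A" for Q
    by (rule matrix_eq_on_spanning_set[OF sp]) (simp only: act[OF that B] act[OF P B])
  then have "msqrt A = P"
    unfolding msqrt_def using P by blast
  then show "psd_real (msqrt A)" "msqrt A ** msqrt A = A"
    "\<And>B b. eigenbasis A B \<Longrightarrow> b \<in> B \<Longrightarrow> msqrt A *v b = sqrt (b \<bullet> (A *v b)) *\<^sub>R b"
    using P act by auto
qed

lemma psd_real_gram: "psd_real (transpose A ** (A :: real^'d^'d))"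
proof -
  have "x \<bullet> ((transpose A ** A) *v x) = (A *v x) \<bullet> (A *v x)" for x
    using inner_matrix_transpose[of x "transpose A" "A *v x"] by (simp add: matrix_vector_mul_assoc)
  then show ?thesis by (simp add: psd_real_def matrix_transpose_mul)
qed

text \<open>On an eigenvector \<open>b\<close> of \<open>A^T A\<close> the matrix \<open>|A|\<close>
  acts as multiplication by \<open>norm (A *v b)\<close>. This frees the trace norm of matrix square
  roots and makes it a sum that can be estimated term by term.\<close>

lemma trace_abs_eq_sum_norm:
  fixes A :: "real^'d^'d"
  assumes B: "eigenbasis (transpose A ** A) B"
  shows "trace_abs A = (\<Sum>b\<in>B. norm (A *v b))"
proof -
  have on: "orthonormal B" and sp: "span B = UNIV" using B by (auto simp: eigenbasis_def)
  have "trace_abs A = (\<Sum>b\<in>B. b \<bullet> (msqrt (transpose A ** A) *v b))"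
    unfolding trace_abs_def by (rule trace_orthonormal_basis[OF on sp])
  also have "\<dots> = (\<Sum>b\<in>B. norm (A *v b))"
  proof (rule sum.cong[OF refl])
    fix b assume b: "b \<in> B"
    have "b \<bullet> ((transpose A ** A) *v b) = (A *v b) \<bullet> (A *v b)"
      using inner_matrix_transpose[of b "transpose A" "A *v b"] by (simp add: matrix_vector_mul_assoc)
    then have "sqrt (b \<bullet> ((transpose A ** A) *v b)) = norm (A *v b)"
      by (simp add: norm_eq_sqrt_inner)
    then show "b \<bullet> (msqrt (transpose A ** A) *v b) = norm (A *v b)"
      using msqrt_eigenbasis[OF psd_real_gram B b] orthonormal_inner[OF on b b] by simp
  qed
  finally show ?thesis .
qed

lemma trace_abs_nonneg: "0 \<le> trace_abs (A :: real^'d^'d)"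
proof -
  obtain B where "eigenbasis (transpose A ** A) B"
    using spectral_theorem_real psd_real_gram[of A] unfolding psd_real_def by blast
  then show ?thesis by (simp add: trace_abs_eq_sum_norm sum_nonneg)
qed

text \<open>The hypothesis says that the complex matrix \<open>W + iB\<close> is nonnegative. It is tested on
  the vectors \<open>b + i g(b)\<close>, where \<open>b\<close> runs over an eigenbasis of \<open>B\<^sup>TB\<close> and \<open>g\<close> is
  the partial isometry of the polar decomposition of \<open>B\<close>, extended by the identity on the kernel;
  antisymmetry of \<open>B\<close> makes the image of \<open>g\<close> again orthonormal.\<close>
lemma trace_abs_le_trace:
  fixes W B :: "real^'d^'d"
  assumes anti: "transpose B = - B"
    and le: "\<And>a b. 2 * (b \<bullet> (B *v a)) \<le> a \<bullet> (W *v a) + b \<bullet> (W *v b)"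
  shows "trace_abs B \<le> trace W"
proof -
  obtain E where E: "eigenbasis (transpose B ** B) E"
    using spectral_theorem_real psd_real_gram[of B] unfolding psd_real_def by blast
  have on: "orthonormal E" and sp: "span E = UNIV"
    using E by (auto simp: eigenbasis_def)
  have fin: "finite E" using on orthonormal_finite by blast
  define g where "g b = (if B *v b = 0 then b else inverse (norm (B *v b)) *\<^sub>R (B *v b))" for b
  have BB: "(B *v b) \<bullet> (B *v c) = 0" if "b \<in> E" "c \<in> E" "b \<noteq> c" for b c
  proof -
    have "(B *v b) \<bullet> (B *v c) = b \<bullet> ((transpose B ** B) *v c)"
      using inner_matrix_transpose[of b "transpose B" "B *v c"] by (simp add: matrix_vector_mul_assoc)
    also obtain l where "(transpose B ** B) *v c = l *\<^sub>R c" using E \<open>c \<in> E\<close> by (auto simp: eigenbasis_def)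
    also have "b \<bullet> (l *\<^sub>R c) = 0" using orthonormal_inner[OF on that(1,2)] that(3) by simp
    finally show ?thesis .
  qed
  \<comment> \<open>Antisymmetry makes the range of \<open>B\<close> orthogonal to its kernel, so
    the kernel vectors that \<open>g\<close> keeps are orthogonal to the normalised images of the
    other ones.\<close>
  have kerB: "b \<bullet> (B *v c) = 0" if "B *v b = 0" for b c
  proof -
    have "(- B) *v b = - (B *v b)" by (simp add: vec_eq_iff matrix_vector_mult_def sum_negf)
    then show ?thesis using inner_matrix_transpose[of b B c] anti that by simp
  qed
  have gn: "norm (g b) = 1" if "b \<in> E" for b
    using on that by (auto simp: g_def orthonormal_def)
  have go: "g b \<bullet> g c = 0" if "b \<in> E" "c \<in> E" "b \<noteq> c" for b c
    using BB[OF that] kerB[of b c] kerB[of c b] orthonormal_inner[OF on that(1,2)] that(3)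
    by (auto simp: g_def inner_commute)
  have inj: "inj_on g E"
  proof (rule inj_onI, rule ccontr)
    fix b c assume "b \<in> E" "c \<in> E" "g b = g c" "b \<noteq> c"
    then show False using go[of b c] gn[of c] by (auto simp: dot_square_norm)
  qed
  have on': "orthonormal (g ` E)"
    unfolding orthonormal_def pairwise_def orthogonal_def using go gn by force
  have sp': "span (g ` E) = UNIV"
  proof -
    have "card E = DIM(real^'d)"
      using orthonormal_independent[OF on] sp by (metis dim_UNIV dim_span dim_eq_card_independent)
    then have "card (g ` E) = DIM(real^'d)" using inj by (simp add: card_image)
    then show ?thesis
      using card_ge_dim_independent[of "g ` E" UNIV] orthonormal_independent[OF on'] by auto
  qed
  have "2 * trace_abs B = (\<Sum>b\<in>E. 2 * (g b \<bullet> (B *v b)))"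
    unfolding trace_abs_eq_sum_norm[OF E] sum_distrib_left
    by (rule sum.cong) (auto simp: g_def dot_square_norm power2_eq_square)
  \<comment> \<open>The hypothesis at the pair \<open>b\<close>, \<open>g b\<close>. The sum
    contains the trace of \<open>W\<close> twice, once in the basis \<open>E\<close> and once in its
    image under \<open>g\<close>, which cancels the factor 2.\<close>
  also have "\<dots> \<le> (\<Sum>b\<in>E. b \<bullet> (W *v b) + g b \<bullet> (W *v g b))"
    by (rule sum_mono) (rule le)
  also have "\<dots> = trace W + (\<Sum>b\<in>g ` E. b \<bullet> (W *v b))"
    using inj by (simp add: sum.distrib trace_orthonormal_basis[OF on sp] sum.reindex)
  also have "\<dots> = 2 * trace W" by (simp add: trace_orthonormal_basis[OF on' sp', symmetric])
  finally show ?thesis by simp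
qed

subsection \<open>Matrix algebra\<close>

text \<open>Entries at all indices are conjugated, also those outside the dimension.
  Self-adjointness in the form \<open>adj A = A\<close> can therefore be used for rewriting, whereas
  \<open>hermitian m A\<close> speaks of a finite block.\<close>

definition adj :: "cmat \<Rightarrow> cmat" where
  "adj A = (\<lambda>i j. cnj (A j i))"

definition munit :: "nat \<Rightarrow> nat \<Rightarrow> cmat" where
  "munit a b = (\<lambda>i j. if i = a \<and> j = b then 1 else 0)"

lemma adj_adj [simp]: "adj (adj A) = A"
  by (simp add: adj_def)

lemma adj_munit: "adj (munit a b) = munit b a"
  by (auto simp: adj_def munit_def fun_eq_iff)

lemma hermitian_if_adj_eq: "adj A = A \<Longrightarrow> hermitian m A"
  unfolding hermitian_def adj_def by metis

lemma mmul_assoc: "mmul m (mmul m A B) C = mmul m A (mmul m B C)"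
  unfolding mmul_def sum_distrib_left sum_distrib_right
  by (intro ext, subst sum.swap) (simp add: mult.assoc)

lemma adj_mmul: "adj (mmul m A B) = mmul m (adj B) (adj A)"
  by (simp add: adj_def mmul_def mult.commute)

lemma mtr_adj: "mtr m (adj A) = cnj (mtr m A)"
  by (simp add: mtr_def adj_def)

lemma mtr_mmul_comm: "mtr m (mmul m A B) = mtr m (mmul m B A)"
  unfolding mtr_def mmul_def by (subst sum.swap) (simp add: mult.commute)

lemma mtr_mmul_rotate: "mtr m (mmul m A (mmul m B C)) = mtr m (mmul m B (mmul m C A))"
  by (metis mmul_assoc mtr_mmul_comm)

lemma mtr_cong: "meq m A B \<Longrightarrow> mtr m A = mtr m B"
  by (simp add: mtr_def meq_def)

lemma mmul_cong: "meq m A A' \<Longrightarrow> meq m B B' \<Longrightarrow> meq m (mmul m A B) (mmul m A' B')"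
  by (simp add: mmul_def meq_def)

lemma meq_refl [simp]: "meq m A A"
  by (simp add: meq_def)

lemma meq_sym: "meq m A B \<Longrightarrow> meq m B A"
  by (simp add: meq_def)

lemma meq_trans: "meq m A B \<Longrightarrow> meq m B C \<Longrightarrow> meq m A C"
  by (simp add: meq_def)

lemma meq_adj: "meq m A B \<Longrightarrow> meq m (adj A) (adj B)"
  by (simp add: meq_def adj_def)

lemma mmul_mid: "meq m (mmul m A mid) A" "meq m (mmul m mid A) A"
  by (auto simp: meq_def mmul_def mid_def if_distrib[of "\<lambda>x. _ * x"] if_distrib[of "\<lambda>x. x * _"] cong: if_cong)

lemma mtr_mmul_mid: "mtr m (mmul m A mid) = mtr m A"
  using mtr_cong[OF mmul_mid(1)] .

lemma mmul_sum_right: "mmul m A (\<lambda>i j. \<Sum>k\<in>I. c k * X k i j) = (\<lambda>i j. \<Sum>k\<in>I. c k * mmul m A (X k) i j)"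
  unfolding mmul_def sum_distrib_left by (intro ext, subst sum.swap) (simp add: mult_ac)

lemma mmul_sum_left: "mmul m (\<lambda>i j. \<Sum>k\<in>I. c k * X k i j) A = (\<lambda>i j. \<Sum>k\<in>I. c k * mmul m (X k) A i j)"
  unfolding mmul_def sum_distrib_left sum_distrib_right
  by (intro ext, subst sum.swap) (simp add: mult_ac)

lemma mtr_sum: "mtr m (\<lambda>i j. \<Sum>k\<in>I. c k * X k i j) = (\<Sum>k\<in>I. c k * mtr m (X k))"
  unfolding mtr_def sum_distrib_left by (rule sum.swap)

lemma adj_sum: "adj (\<lambda>i j. \<Sum>k\<in>I. c k * X k i j) = (\<lambda>i j. \<Sum>k\<in>I. cnj (c k) * adj (X k) i j)"
  by (simp add: adj_def)

lemma mmul_scale_left: "mmul m (\<lambda>i j. c * A i j) B = (\<lambda>i j. c * mmul m A B i j)"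
  by (simp add: mmul_def sum_distrib_left mult_ac)

lemma mmul_scale_right: "mmul m A (\<lambda>i j. c * B i j) = (\<lambda>i j. c * mmul m A B i j)"
  by (simp add: mmul_def sum_distrib_left mult_ac)

lemma mtr_scale: "mtr m (\<lambda>i j. c * A i j) = c * mtr m A"
  by (simp add: mtr_def sum_distrib_left)

lemma adj_scale: "adj (\<lambda>i j. c * A i j) = (\<lambda>i j. cnj c * adj A i j)"
  by (simp add: adj_def)

lemma mmul_add_left: "mmul m (\<lambda>i j. A i j + B i j) C = (\<lambda>i j. mmul m A C i j + mmul m B C i j)"
  by (simp add: mmul_def distrib_right sum.distrib)

lemma mmul_add_right: "mmul m C (\<lambda>i j. A i j + B i j) = (\<lambda>i j. mmul m C A i j + mmul m C B i j)"
  by (simp add: mmul_def distrib_left sum.distrib)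

lemma mtr_add: "mtr m (\<lambda>i j. A i j + B i j) = mtr m A + mtr m B"
  by (simp add: mtr_def sum.distrib)

lemma adj_add: "adj (\<lambda>i j. A i j + B i j) = (\<lambda>i j. adj A i j + adj B i j)"
  by (simp add: adj_def)

subsection \<open>Tensor powers\<close>

lemma sum_div_mod:
  fixes f :: "nat \<Rightarrow> nat \<Rightarrow> 'a::comm_monoid_add"
  shows "(\<Sum>k<M*N. f (k div N) (k mod N)) = (\<Sum>i<M. \<Sum>j<N. f i j)"
proof (cases "N = 0")
  case False
  have "(\<Sum>i<M. \<Sum>j<N. f i j) = (\<Sum>(i,j)\<in>{..<M}\<times>{..<N}. f i j)"
    by (simp add: sum.cartesian_product)
  also have "\<dots> = (\<Sum>k<M*N. f (k div N) (k mod N))"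
  proof (rule sum.reindex_bij_witness[of _ "\<lambda>k. (k div N, k mod N)" "\<lambda>(i,j). i * N + j"])
    fix p assume "p \<in> {..<M}\<times>{..<N}"
    then obtain i j where p: "p = (i,j)" "i < M" "j < N" by auto
    have "i * N + j < Suc i * N" using p by simp
    also have "\<dots> \<le> M * N" using p by (intro mult_right_mono) auto
    finally show "(case p of (i, j) \<Rightarrow> i * N + j) \<in> {..<M * N}" using p by simp
  qed (use False in \<open>auto simp: less_mult_imp_div_less\<close>)
  finally show ?thesis by simp
qed simp

lemma kron_mmul: "mmul (M*N) (kron N A B) (kron N C D) = kron N (mmul M A C) (mmul N B D)"
proof (intro ext)
  fix i j
  have "mmul (M*N) (kron N A B) (kron N C D) i j =
     (\<Sum>k<M*N. (\<lambda>a b. (A (i div N) a * C a (j div N)) * (B (i mod N) b * D b (j mod N))) (k div N) (k mod N))"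
    by (simp add: mmul_def kron_def mult_ac)
  also have "\<dots> = kron N (mmul M A C) (mmul N B D) i j"
    by (subst sum_div_mod) (simp add: mmul_def kron_def sum_product)
  finally show "mmul (M*N) (kron N A B) (kron N C D) i j = kron N (mmul M A C) (mmul N B D) i j" .
qed

lemma mtr_kron: "mtr (M*N) (kron N A B) = mtr M A * mtr N B"
proof -
  have "mtr (M*N) (kron N A B) = (\<Sum>k<M*N. (\<lambda>a b. A a a * B b b) (k div N) (k mod N))"
    by (simp add: mtr_def kron_def)
  also have "\<dots> = mtr M A * mtr N B"
    by (subst sum_div_mod) (simp add: mtr_def sum_product)
  finally show ?thesis .
qed

lemma adj_kron: "adj (kron N A B) = kron N (adj A) (adj B)"
  by (simp add: adj_def kron_def)

lemma kron_cong:
  assumes "meq M A A'" "meq N B B'"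
  shows "meq (M*N) (kron N A B) (kron N A' B')"
proof (cases "N = 0")
  case False
  then show ?thesis
    using assms by (auto simp: meq_def kron_def less_mult_imp_div_less)
qed (simp add: meq_def)

lemma kron_mid: "kron N mid mid = mid"
proof -
  have "(i div N = j div N \<and> i mod N = j mod N) = (i = j)" for i j
    by (metis div_mult_mod_eq)
  then show ?thesis by (auto simp: kron_def mid_def fun_eq_iff)
qed

lemma tpow_mmul: "mmul (N^n) (tpow N n A) (tpow N n B) = tpow N n (mmul N A B)"
proof (induction n)
  case 0
  then show ?case by (simp add: mmul_def)
next
  case (Suc n)
  then show ?case using kron_mmul[of "N^n" N] by (simp add: mult.commute)
qed

lemma mtr_tpow: "mtr (N^n) (tpow N n A) = mtr N A ^ n"
proof (induction n)
  case 0
  then show ?case by (simp add: mtr_def)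
next
  case (Suc n)
  then show ?case using mtr_kron[of "N^n" N] by (simp add: mult.commute)
qed

lemma adj_tpow: "adj (tpow N n A) = tpow N n (adj A)"
  by (induction n) (simp_all add: adj_kron, simp add: adj_def)

lemma tpow_cong: "meq N A B \<Longrightarrow> meq (N^n) (tpow N n A) (tpow N n B)"
proof (induction n)
  case (Suc n)
  then show ?case using kron_cong[of "N^n" _ _ N] by (simp add: mult.commute)
qed simp

lemma tpow_mid: "meq (N^n) (tpow N n mid) mid"
proof (induction n)
  case 0
  then show ?case by (simp add: meq_def mid_def)
next
  case (Suc n)
  then show ?case using kron_cong[of "N^n" "tpow N n mid" mid N mid mid]
    by (simp add: mult.commute kron_mid)
qed

text \<open>The derivation \<open>\<Sum>\<^sub>i A \<otimes> \<dots> \<otimes> K \<otimes> \<dots> \<otimes> A\<close>, the derivative of the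
  tensor power at \<open>A\<close> in direction \<open>K\<close>.\<close>
primrec tder :: "nat \<Rightarrow> cmat \<Rightarrow> nat \<Rightarrow> cmat \<Rightarrow> cmat" where
  "tder N A 0 K = (\<lambda>i j. 0)"
| "tder N A (Suc n) K = (\<lambda>i j. kron N (tder N A n K) A i j + kron N (tpow N n A) K i j)"

lemma adj_tder: "adj (tder N A n K) = tder N (adj A) n (adj K)"
  by (induction n) (simp_all add: adj_add adj_kron adj_tpow, simp add: adj_def)

lemma tder_cong: "meq N A A' \<Longrightarrow> meq N K K' \<Longrightarrow> meq (N^n) (tder N A n K) (tder N A' n K')"
proof (induction n)
  case (Suc n)
  have "meq (N^n*N) (kron N (tder N A n K) A) (kron N (tder N A' n K') A')"
    "meq (N^n*N) (kron N (tpow N n A) K) (kron N (tpow N n A') K')"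
    using Suc by (auto intro!: kron_cong tpow_cong)
  then show ?case by (simp add: meq_def mult.commute)
qed simp

text \<open>\<open>tpow_mmul\<close> differentiated in its second factor: multiplication by
  \<open>tpow N n A\<close> takes the tensor powers of the curve \<open>B + s K\<close> to those of
  \<open>A B + s A K\<close>.\<close>

lemma tpow_mmul_tder:
  "mmul (N^n) (tpow N n A) (tder N B n K) = tder N (mmul N A B) n (mmul N A K)"
proof (induction n)
  case 0
  then show ?case by (simp add: mmul_def)
next
  case (Suc n)
  have e: "N ^ Suc n = N ^ n * N" by simp
  show ?case
    unfolding e tder.simps tpow.simps mmul_add_right kron_mmul tpow_mmul Suc by simp
qed

text \<open>Expand over pairs of sites. Two different sites contribute a factor
  \<open>Tr (adj A K) = 0\<close> or its conjugate; for equal sites the remaining factors are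
  \<open>Tr (adj A A) = 1\<close>. Hence the growth is \<open>n\<close> and not
  \<open>n^2\<close>.\<close>

lemma mtr_tder_gram:
  assumes A: "mtr N (mmul N (adj A) A) = 1" and K: "mtr N (mmul N (adj A) K) = 0"
  shows "mtr (N^n) (mmul (N^n) (adj (tder N A n K)) (tder N A n K)) = of_nat n * mtr N (mmul N (adj K) K)"
proof (induction n)
  case 0
  then show ?case by (simp add: mtr_def mmul_def adj_def)
next
  case (Suc n)
  have K': "mtr N (mmul N (adj K) A) = 0"
    using K mtr_adj[of N "mmul N (adj A) K"] by (simp add: adj_mmul)
  have AA: "mtr (N^n) (mmul (N^n) (tpow N n (adj A)) (tpow N n A)) = 1"
    by (simp add: tpow_mmul mtr_tpow A)
  have e: "N ^ Suc n = N ^ n * N" by simp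
  show ?case
    unfolding e tder.simps adj_add adj_kron adj_tpow mmul_add_right mmul_add_left kron_mmul mtr_add mtr_kron
      Suc K K' A AA by (simp add: algebra_simps)
qed

text \<open>Linearity in the direction \<open>K\<close>. It allows a trace functional of
  \<open>tder N A n K\<close> to be represented by a single-copy matrix whose entries are its values
  at the matrix units.\<close>

lemma tder_expand:
  assumes "0 < N"
  shows "tder N A n K = (\<lambda>i j. \<Sum>p\<in>{..<N}\<times>{..<N}. K (fst p) (snd p) * tder N A n (munit (fst p) (snd p)) i j)"
proof (induction n)
  case (Suc n)
  have KK: "K i j = (\<Sum>p\<in>{..<N}\<times>{..<N}. K (fst p) (snd p) * munit (fst p) (snd p) i j)"
    if "i < N" "j < N" for i j
  proof -
    have "(\<Sum>p\<in>{..<N}\<times>{..<N}. K (fst p) (snd p) * munit (fst p) (snd p) i j)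
       = (\<Sum>p\<in>{..<N}\<times>{..<N}. if p = (i,j) then K i j else 0)"
      by (rule sum.cong) (auto simp: munit_def)
    then show ?thesis using that by simp
  qed
  show ?case
  proof (intro ext)
    fix i j
    \<comment> \<open>\<open>0 < N\<close> keeps both remainders in range for arbitrary
      \<open>i\<close> and \<open>j\<close>, so the equation holds between functions and not just on
      a block.\<close>
    have m: "i mod N < N" "j mod N < N" using assms by auto
    show "tder N A (Suc n) K i j = (\<Sum>p\<in>{..<N}\<times>{..<N}. K (fst p) (snd p) * tder N A (Suc n) (munit (fst p) (snd p)) i j)"
      by (simp add: kron_def distrib_left sum.distrib)
        (subst Suc.IH, subst KK[OF m], simp add: sum_distrib_left sum_distrib_right mult_ac)
  qed
qed simp

subsection \<open>Positive matrices\<close>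

lemma mtr_conjugate: "mtr m (mmul m (adj P) (mmul m A P)) = (\<Sum>k<m. qform m A (\<lambda>i. P i k))"
  by (simp add: mtr_def mmul_def adj_def qform_def sum_distrib_left mult.assoc)

lemma qform_conjugate:
  "qform m (mmul m (adj P) (mmul m A P)) v = qform m A (\<lambda>i. \<Sum>j<m. P i j * v j)"
proof -
  have "qform m (mmul m (adj P) (mmul m A P)) v
     = (\<Sum>i<m. \<Sum>j<m. \<Sum>k<m. \<Sum>l<m. cnj (P k i * v i) * A k l * (P l j * v j))"
    by (simp add: qform_def mmul_def adj_def sum_distrib_left sum_distrib_right mult_ac)
  also have "\<dots> = (\<Sum>i<m. \<Sum>k<m. \<Sum>j<m. \<Sum>l<m. cnj (P k i * v i) * A k l * (P l j * v j))"
    by (rule sum.cong[OF refl], rule sum.swap)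
  also have "\<dots> = (\<Sum>k<m. \<Sum>i<m. \<Sum>l<m. \<Sum>j<m. cnj (P k i * v i) * A k l * (P l j * v j))"
    by (subst sum.swap, rule sum.cong[OF refl], rule sum.cong[OF refl], rule sum.swap)
  also have "\<dots> = (\<Sum>k<m. \<Sum>l<m. \<Sum>i<m. \<Sum>j<m. cnj (P k i * v i) * A k l * (P l j * v j))"
    by (rule sum.cong[OF refl], rule sum.swap)
  also have "\<dots> = (\<Sum>k<m. \<Sum>l<m. \<Sum>j<m. \<Sum>i<m. cnj (P k i * v i) * A k l * (P l j * v j))"
    by (rule sum.cong[OF refl], rule sum.cong[OF refl], rule sum.swap)
  also have "\<dots> = qform m A (\<lambda>i. \<Sum>j<m. P i j * v j)"
    by (simp add: qform_def sum_distrib_left sum_distrib_right)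
  finally show ?thesis .
qed

lemma psd_conjugate_trace_nonneg:
  "psd m A \<Longrightarrow> 0 \<le> Re (mtr m (mmul m (adj P) (mmul m A P)))"
  unfolding mtr_conjugate by (auto simp: psd_def intro!: sum_nonneg)

lemma psd_conjugate:
  assumes "psd m A" "adj A = A"
  shows "psd m (mmul m (adj P) (mmul m A P))"
  using assms unfolding psd_def qform_conjugate
  by (auto intro!: hermitian_if_adj_eq simp: adj_mmul mmul_assoc)

lemma qform_two:
  assumes "i < m" "j < m" "i \<noteq> j"
  shows "qform m A (\<lambda>k. if k = i then a else if k = j then b else 0) =
     cnj a * A i i * a + cnj a * A i j * b + cnj b * A j i * a + cnj b * A j j * b"
proof -
  let ?v = "\<lambda>k. if k = i then a else if k = j then b else 0"
  have s: "(\<Sum>k<m. f k) = f i + f j" if "\<And>k. k \<noteq> i \<Longrightarrow> k \<noteq> j \<Longrightarrow> f k = 0" for f :: "nat \<Rightarrow> complex"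
  proof -
    have "(\<Sum>k<m. f k) = (\<Sum>k\<in>{i,j}. f k)"
      by (rule sum.mono_neutral_right) (use assms that in auto)
    then show ?thesis using assms by simp
  qed
  show ?thesis unfolding qform_def
    by (subst s, simp, subst (1 2) s) (use assms in \<open>auto simp: algebra_simps\<close>)
qed

lemma qform_one:
  assumes "i < m"
  shows "qform m A (\<lambda>k. if k = i then a else 0) = cnj a * A i i * a"
proof -
  have s: "(\<Sum>k<m. f k) = f i" if "\<And>k. k \<noteq> i \<Longrightarrow> f k = 0" for f :: "nat \<Rightarrow> complex"
  proof -
    have "(\<Sum>k<m. f k) = (\<Sum>k\<in>{i}. f k)"
      by (rule sum.mono_neutral_right) (use assms that in auto)
    then show ?thesis by simp
  qed
  show ?thesis unfolding qform_def by (subst s, simp, subst s, auto)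
qed

lemma psd_diag:
  assumes "psd m A" "i < m"
  shows "0 \<le> Re (A i i)" "Im (A i i) = 0"
proof -
  have "qform m A (\<lambda>k. if k = i then 1 else 0) = A i i"
    using qform_one[OF assms(2), of A 1] by simp
  then show "0 \<le> Re (A i i)" using assms unfolding psd_def by metis
  have "A i i = cnj (A i i)" using assms unfolding psd_def hermitian_def by blast
  then show "Im (A i i) = 0" by (metis complex_cnj_cancel_iff complex_eq_iff cnj.sel(2) neg_equal_zero)
qed

text \<open>The quadratic form at a difference of two basis vectors with a suitable phase bounds
  twice the modulus of the entry by two diagonal entries. Consequences used later: a density of
  trace one has bounded entries, and a positive matrix of trace zero vanishes.\<close>

lemma psd_entry_le_trace:
  assumes A: "psd m A" and ij: "i < m" "j < m"
  shows "cmod (A i j) \<le> Re (mtr m A)"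
proof -
  have nn: "0 \<le> Re (A k k)" if "k < m" for k using psd_diag[OF A that] by simp
  have tr: "Re (mtr m A) = (\<Sum>k<m. Re (A k k))" by (simp add: mtr_def)
  show ?thesis
  proof (cases "i = j")
    case True
    have "cmod (A i i) = Re (A i i)"
      using psd_diag[OF A ij(1)] by (simp add: cmod_def)
    also have "\<dots> \<le> (\<Sum>k<m. Re (A k k))"
      by (rule member_le_sum) (use ij nn in auto)
    finally show ?thesis using True tr by simp
  next
    case False
    \<comment> \<open>The phase that rotates \<open>A i j\<close> to its modulus.\<close>
    obtain u where u: "cmod u = 1" "u * A i j = cmod (A i j)"
    proof (cases "A i j = 0")
      case True then show ?thesis using that[of 1] by simp
    next
      case False
      show ?thesis
      proof (rule that[of "cnj (A i j) / cmod (A i j)"])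
        show "cnj (A i j) / complex_of_real (cmod (A i j)) * A i j = complex_of_real (cmod (A i j))"
          using False complex_norm_square[of "A i j"]
          by (simp add: field_simps power2_eq_square)
      qed (use False in \<open>simp add: norm_divide\<close>)
    qed
    have uu: "cnj u * u = 1" using u(1) complex_norm_square[of u] by (simp add: mult.commute)
    have h: "A j i = cnj (A i j)" using A ij unfolding psd_def hermitian_def by blast
    have h2: "cnj u * cnj (A i j) = cmod (A i j)"
      using u(2) by (metis complex_cnj_complex_of_real complex_cnj_mult)
    have "0 \<le> Re (qform m A (\<lambda>k. if k = i then 1 else if k = j then - u else 0))"
      using A unfolding psd_def by blast
    also have "qform m A (\<lambda>k. if k = i then 1 else if k = j then - u else 0)
       = A i i - u * A i j - cnj u * cnj (A i j) + (cnj u * u) * A j j"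
      unfolding qform_two[OF ij False] h by (simp add: algebra_simps)
    finally have "2 * cmod (A i j) \<le> Re (A i i) + Re (A j j)"
      unfolding u(2) h2 uu by simp
    also have "\<dots> = (\<Sum>k\<in>{i,j}. Re (A k k))" using False by simp
    also have "\<dots> \<le> (\<Sum>k<m. Re (A k k))"
      by (rule sum_mono2) (use ij nn in auto)
    finally show ?thesis using tr norm_ge_zero[of "A i j"] by linarith
  qed
qed

text \<open>With \<open>P = (adj R) A R\<close> one has \<open>tr A = tr (P Q (adj Q))\<close>, and
  the entries of the positive matrix \<open>P\<close> are at most its trace, which is
  \<open>tr (A R (adj R))\<close>. The constant depends only on \<open>Q\<close>, so an invertible
  state \<open>R (adj R)\<close> controls the trace uniformly in \<open>A\<close>.\<close>

lemma trace_le_trace_conjugate: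
  assumes A: "psd m A" "adj A = A" and RQ: "meq m (mmul m R Q) mid"
  shows "Re (mtr m A) \<le> (\<Sum>i<m. \<Sum>j<m. cmod (mmul m Q (adj Q) j i)) * Re (mtr m (mmul m A (mmul m R (adj R))))"
proof -
  define P where "P = mmul m (adj R) (mmul m A R)"
  have P: "psd m P" unfolding P_def by (rule psd_conjugate[OF A])
  have tP: "mtr m P = mtr m (mmul m A (mmul m R (adj R)))"
    unfolding P_def by (simp add: mmul_assoc mtr_mmul_rotate[of m "adj R"])
  have "meq m (mmul m (mmul m R Q) (adj (mmul m R Q))) (mmul m mid (adj mid))"
    by (intro mmul_cong meq_adj RQ)
  also have "adj mid = mid" by (auto simp: adj_def mid_def fun_eq_iff)
  finally have "meq m (mmul m (mmul m R Q) (adj (mmul m R Q))) mid"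
    using meq_trans[OF _ mmul_mid(1)] by blast
  from mtr_cong[OF mmul_cong[OF meq_refl[of m A] this]]
  have "mtr m (mmul m A (mmul m (mmul m R Q) (adj (mmul m R Q)))) = mtr m A"
    by (simp only: mtr_mmul_mid)
  then have "mtr m A = mtr m (mmul m A (mmul m R (mmul m Q (mmul m (adj Q) (adj R)))))"
    by (simp add: adj_mmul mmul_assoc)
  also have "\<dots> = mtr m (mmul m P (mmul m Q (adj Q)))"
    unfolding P_def mmul_assoc mtr_mmul_rotate[of m "adj R"] by (simp only: mmul_assoc)
  also have "\<dots> = (\<Sum>i<m. \<Sum>j<m. P i j * mmul m Q (adj Q) j i)"
    by (simp add: mtr_def mmul_def[of m P])
  finally have eq: "mtr m A = (\<Sum>i<m. \<Sum>j<m. P i j * mmul m Q (adj Q) j i)" .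
  have "Re (mtr m A) \<le> cmod (mtr m A)" by (rule complex_Re_le_cmod)
  also have "\<dots> \<le> (\<Sum>i<m. \<Sum>j<m. cmod (P i j) * cmod (mmul m Q (adj Q) j i))"
    unfolding eq by (rule sum_norm_le, rule sum_norm_le) (simp add: norm_mult)
  also have "\<dots> \<le> (\<Sum>i<m. \<Sum>j<m. Re (mtr m P) * cmod (mmul m Q (adj Q) j i))"
    by (intro sum_mono mult_right_mono psd_entry_le_trace[OF P]) auto
  finally show ?thesis unfolding tP by (simp add: sum_distrib_left sum_distrib_right mult.commute)
qed

subsection \<open>Factorisation and reduction to a single copy\<close>

text \<open>Cholesky factorisation by induction on the size, carrying the inverse of the triangular
  factor along. The new row comes from solving \<open>R' r = b\<close> for the last column
  \<open>b\<close>; the new diagonal entry is the root of the Schur complement.\<close>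

lemma pos_def_factor:
  "pos_def m A \<Longrightarrow> \<exists>R Q. meq m A (mmul m R (adj R)) \<and> meq m (mmul m R Q) mid \<and> meq m (mmul m Q R) mid"
proof (induction m)
  case 0
  then show ?case by (simp add: meq_def)
next
  case (Suc m)
  have her: "\<And>i j. i < Suc m \<Longrightarrow> j < Suc m \<Longrightarrow> A j i = cnj (A i j)"
    using Suc.prems unfolding pos_def_def hermitian_def by blast
  have "pos_def m A"
    unfolding pos_def_def
  proof (intro conjI allI impI)
    show "hermitian m A" unfolding hermitian_def using her less_SucI by blast
    fix v :: "nat \<Rightarrow> complex" assume v: "\<exists>i<m. v i \<noteq> 0"
    define w where "w = (\<lambda>i. if i < m then v i else 0)"
    have "qform (Suc m) A w = qform m A v" by (simp add: qform_def w_def)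
    moreover have "\<exists>i<Suc m. w i \<noteq> 0" using v by (auto simp: w_def)
    ultimately show "0 < Re (qform m A v)" using Suc.prems unfolding pos_def_def by metis
  qed
  with Suc.IH obtain R' Q' where R': "meq m A (mmul m R' (adj R'))"
    and RQ: "meq m (mmul m R' Q') mid" and QR: "meq m (mmul m Q' R') mid" by blast
  \<comment> \<open>Column vectors are stored as matrices constant in the second index, so that the
    rules for \<open>mmul\<close> apply; column 0 is read off afterwards.\<close>
  define bM :: cmat where "bM = (\<lambda>i j. A i m)"
  define rM where "rM = mmul m Q' bM"
  define uM where "uM = mmul m (adj Q') rM"
  define r where "r i = rM i 0" for i
  define u where "u i = uM i 0" for i
  have Rr: "meq m (mmul m R' rM) bM"
  proof -
    have "meq m (mmul m (mmul m R' Q') bM) (mmul m mid bM)" by (intro mmul_cong RQ meq_refl)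
    then show ?thesis unfolding rM_def mmul_assoc using mmul_mid(2) meq_trans by blast
  qed
  have adjmid: "adj mid = mid" by (auto simp: adj_def mid_def fun_eq_iff)
  have Au: "meq m (mmul m A uM) bM"
  proof -
    have "meq m (mmul m A uM) (mmul m (mmul m R' (adj R')) uM)" by (intro mmul_cong R' meq_refl)
    also have "mmul m (mmul m R' (adj R')) uM = mmul m R' (mmul m (adj (mmul m Q' R')) rM)"
      unfolding uM_def adj_mmul mmul_assoc ..
    finally have 1: "meq m (mmul m A uM) (mmul m R' (mmul m (adj (mmul m Q' R')) rM))" .
    have "meq m (mmul m (adj (mmul m Q' R')) rM) (mmul m (adj mid) rM)"
      by (intro mmul_cong meq_adj QR meq_refl)
    then have "meq m (mmul m (adj (mmul m Q' R')) rM) rM"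
      unfolding adjmid using mmul_mid(2) meq_trans by blast
    then have "meq m (mmul m R' (mmul m (adj (mmul m Q' R')) rM)) (mmul m R' rM)"
      by (intro mmul_cong meq_refl)
    with 1 Rr show ?thesis using meq_trans by blast
  qed
  have r: "r i = (\<Sum>j<m. Q' i j * A j m)" for i
    by (simp add: r_def rM_def mmul_def bM_def)
  have Rr': "(\<Sum>j<m. R' i j * r j) = A i m" if "i < m" for i
  proof -
    have "mmul m R' rM i 0 = bM i 0" using Rr that by (auto simp: meq_def)
    then show ?thesis by (simp add: mmul_def r_def bM_def)
  qed
  have Au': "(\<Sum>j<m. A i j * u j) = A i m" if "i < m" for i
  proof -
    have "mmul m A uM i 0 = bM i 0" using Au that by (auto simp: meq_def)
    then show ?thesis by (simp add: mmul_def u_def bM_def)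
  qed
  have u: "u i = (\<Sum>j<m. cnj (Q' j i) * r j)" for i
    by (simp add: u_def uM_def mmul_def adj_def r_def)
  have ub: "(\<Sum>i<m. cnj (u i) * A i m) = (\<Sum>j<m. cnj (r j) * r j)"
  proof -
    have "(\<Sum>i<m. cnj (u i) * A i m) = (\<Sum>i<m. \<Sum>j<m. cnj (r j) * (Q' j i * A i m))"
      by (simp add: u sum_distrib_left sum_distrib_right mult_ac)
    also have "\<dots> = (\<Sum>j<m. cnj (r j) * r j)"
      by (subst sum.swap) (simp add: r sum_distrib_left)
    finally show ?thesis .
  qed
  define q where "q = (\<Sum>j<m. (cmod (r j))^2)"
  have q: "(\<Sum>j<m. cnj (r j) * r j) = of_real q"
    by (simp add: q_def complex_norm_square[symmetric] mult.commute)
  define s where "s = Re (A m m) - q"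
  have Amm: "A m m = of_real (q + s)"
  proof -
    have "cnj (A m m) = A m m" by (rule her[symmetric]) auto
    then have "Im (A m m) = 0" by (metis cnj.sel(2) neg_equal_zero)
    then show ?thesis by (simp add: s_def complex_eq_iff)
  qed
  \<comment> \<open>Since \<open>A u = b\<close>, the quadratic form at \<open>(-u, 1)\<close> is
    exactly the Schur complement \<open>s\<close>, which positive definiteness makes
    positive.\<close>
  define w where "w = (\<lambda>i. if i < m then - u i else (1::complex))"
  have "qform (Suc m) A w = (\<Sum>i<m. cnj (u i) * (\<Sum>j<m. A i j * u j)) - (\<Sum>i<m. cnj (u i) * A i m)
      - (\<Sum>j<m. A m j * u j) + A m m"
    by (simp add: qform_def w_def sum.distrib sum_negf sum_distrib_left mult.assoc sum_subtractf)
  also have "(\<Sum>i<m. cnj (u i) * (\<Sum>j<m. A i j * u j)) = (\<Sum>i<m. cnj (u i) * A i m)"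
    by (rule sum.cong) (auto simp: Au')
  also have "(\<Sum>j<m. A m j * u j) = cnj (\<Sum>i<m. cnj (u i) * A i m)"
    unfolding cnj_sum by (rule sum.cong) (auto simp: her[of _ m])
  finally have "qform (Suc m) A w = of_real s" unfolding ub q Amm by simp
  moreover have "\<exists>i<Suc m. w i \<noteq> 0" by (rule exI[of _ m]) (simp add: w_def)
  ultimately have s: "s > 0" using Suc.prems unfolding pos_def_def by (metis Re_complex_of_real)
  define t where "t = complex_of_real (sqrt s)"
  have t: "t \<noteq> 0" "cnj t = t" "t * t = of_real s"
    using s by (auto simp: t_def simp flip: of_real_mult)
  \<comment> \<open>\<open>R\<close> is block lower triangular with diagonal blocks
    \<open>R'\<close> and \<open>t\<close>. Solving \<open>R Q = 1\<close> by blocks gives the last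
    row of \<open>Q\<close> below.\<close>
  define R where "R = (\<lambda>i j. if i < m \<and> j < m then R' i j else if i = m \<and> j < m then cnj (r j)
      else if i = m \<and> j = m then t else 0)"
  define Q where "Q = (\<lambda>i j. if i < m \<and> j < m then Q' i j else if i = m \<and> j < m then
      - (\<Sum>k<m. cnj (r k) * Q' k j) / t else if i = m \<and> j = m then 1 / t else 0)"
  have R'': "A i j = (\<Sum>k<m. R' i k * cnj (R' j k))" if "i < m" "j < m" for i j
    using R' that by (simp add: meq_def mmul_def adj_def)
  have RQ': "(\<Sum>k<m. R' i k * Q' k j) = (if i = j then 1 else 0)" if "i < m" "j < m" for i j
    using RQ that by (simp add: meq_def mmul_def mid_def)
  have QR': "(\<Sum>k<m. Q' i k * R' k j) = (if i = j then 1 else 0)" if "i < m" "j < m" for i j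
    using QR that by (simp add: meq_def mmul_def mid_def)
  have "meq (Suc m) A (mmul (Suc m) R (adj R))"
    unfolding meq_def
  proof (intro allI impI)
    fix i j assume "i < Suc m" "j < Suc m"
    then consider "i < m" "j < m" | "i < m" "j = m" | "i = m" "j < m" | "i = m" "j = m" by linarith
    then show "A i j = mmul (Suc m) R (adj R) i j"
    proof cases
      case 1
      then show ?thesis by (simp add: mmul_def adj_def R_def R'')
    next
      case 2
      then show ?thesis using Rr'[of i] by (simp add: mmul_def adj_def R_def)
    next
      case 3
      then have "A m j = cnj (\<Sum>k<m. R' j k * r k)" using Rr'[of j] her[of j m] by simp
      then show ?thesis using 3 by (simp add: mmul_def adj_def R_def mult.commute)
    next
      case 4
      then show ?thesis using q by (simp add: mmul_def adj_def R_def t Amm)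
    qed
  qed
  moreover have "meq (Suc m) (mmul (Suc m) R Q) mid"
    unfolding meq_def
  proof (intro allI impI)
    fix i j assume "i < Suc m" "j < Suc m"
    then consider "i < m" "j < m" | "i < m" "j = m" | "i = m" "j < m" | "i = m" "j = m" by linarith
    then show "mmul (Suc m) R Q i j = mid i j"
      by cases (auto simp: mmul_def R_def Q_def RQ' mid_def t)
  qed
  moreover have "meq (Suc m) (mmul (Suc m) Q R) mid"
    unfolding meq_def
  proof (intro allI impI)
    fix i j assume "i < Suc m" "j < Suc m"
    then consider "i < m" "j < m" | "i < m" "j = m" | "i = m" "j < m" | "i = m" "j = m" by linarith
    then show "mmul (Suc m) Q R i j = mid i j"
    proof cases
      case 3
      have "(\<Sum>l<m. (\<Sum>k<m. cnj (r k) * Q' k l) * R' l j) = (\<Sum>k<m. cnj (r k) * (\<Sum>l<m. Q' k l * R' l j))"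
        unfolding sum_distrib_left sum_distrib_right by (subst sum.swap) (simp add: mult.assoc)
      also have "\<dots> = (\<Sum>k<m. cnj (r k) * (if k = j then 1 else 0))"
        by (rule sum.cong) (auto simp: QR' 3)
      also have "\<dots> = cnj (r j)" using 3 by (simp add: if_distrib[of "\<lambda>x. _ * x"] cong: if_cong)
      finally have e: "(\<Sum>l<m. (\<Sum>k<m. cnj (r k) * Q' k l) * R' l j) = cnj (r j)" .
      define y where "y l = (\<Sum>k<m. cnj (r k) * Q' k l)" for l
      have "(\<Sum>k<m. Q m k * R k j) = (\<Sum>l<m. - (y l * R' l j) / t)"
        using 3 by (simp add: Q_def R_def y_def)
      also have "\<dots> = - (\<Sum>l<m. y l * R' l j) / t"
        by (simp add: sum_divide_distrib sum_negf)
      finally have "(\<Sum>k<m. Q m k * R k j) = - (\<Sum>l<m. (\<Sum>k<m. cnj (r k) * Q' k l) * R' l j) / t"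
        by (simp add: y_def)
      then have "(\<Sum>k<m. Q m k * R k j) + Q m m * R m j = 0"
        unfolding e using 3 by (simp add: Q_def R_def)
      then show ?thesis using 3 by (simp add: mmul_def mid_def)
    qed (auto simp: mmul_def R_def Q_def QR' mid_def t)
  qed
  ultimately show ?case by blast
qed

text \<open>From an estimate on \<open>n\<close> copies to one on a single copy: \<open>Y j\<close> represents the functional
  \<open>K \<mapsto> Tr (tder \<sigma> n K) (X j)\<close> on traceless matrices, and the test operator
  \<open>P\<close> is the normalised sum over the sites of \<open>\<Sum>\<^sub>j z\<^sub>j Y\<^sub>j\<close>.\<close>
lemma single_copy_reduction:
  fixes X :: "'d::finite \<Rightarrow> cmat" and V :: "'d \<Rightarrow> 'd \<Rightarrow> complex"
  assumes N: "0 < N" and n: "0 < n" and tr1: "mtr N (mmul N R (adj R)) = 1"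
    and X: "\<And>j. adj (X j) = X j"
    and le: "\<And>z P. 0 \<le> Re (\<Sum>k\<in>UNIV. \<Sum>j\<in>UNIV. cnj (z k) * z j * V k j)
        - 2 * Re (\<Sum>j\<in>UNIV. z j * mtr (N^n) (mmul (N^n) (adj P) (mmul (N^n) (X j) (tpow N n R))))
        + Re (mtr (N^n) (mmul (N^n) (adj P) P))"
  obtains Y :: "'d \<Rightarrow> cmat" where "\<And>j. adj (Y j) = Y j"
    and "\<And>K j. mtr N K = 0 \<Longrightarrow>
      mtr N (mmul N K (Y j)) = mtr (N^n) (mmul (N^n) (tder N (mmul N R (adj R)) n K) (X j))"
    and "\<And>z. Re (\<Sum>k\<in>UNIV. \<Sum>j\<in>UNIV. cnj (z k) * z j * mtr N (mmul N (mmul N R (adj R)) (mmul N (Y k) (Y j))))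
       \<le> real n * Re (\<Sum>k\<in>UNIV. \<Sum>j\<in>UNIV. cnj (z k) * z j * V k j)"
proof -
  define m where "m = N^n"
  define \<sigma> where "\<sigma> = mmul N R (adj R)"
  have \<sigma>h: "adj \<sigma> = \<sigma>" by (simp add: \<sigma>_def adj_mmul)
  \<comment> \<open>The indices of the matrix unit are swapped because \<open>Tr (K Y0)\<close>
    pairs the entry \<open>K a b\<close> with \<open>Y0 b a\<close>.\<close>
  define Y0 where "Y0 j = (\<lambda>a b. mtr m (mmul m (tder N \<sigma> n (munit b a)) (X j)))" for j
  have Y0h: "adj (Y0 j) = Y0 j" for j
  proof (intro ext)
    fix a b
    have "adj (Y0 j) a b = mtr m (adj (mmul m (tder N \<sigma> n (munit a b)) (X j)))"
      unfolding mtr_adj by (simp add: adj_def[of "Y0 j"]) (simp add: Y0_def)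
    also have "\<dots> = Y0 j a b"
      by (simp add: adj_mmul adj_tder \<sigma>h X adj_munit Y0_def mtr_mmul_comm)
    finally show "adj (Y0 j) a b = Y0 j a b" .
  qed
  have Y0: "mtr N (mmul N K (Y0 j)) = mtr m (mmul m (tder N \<sigma> n K) (X j))" for K j
  proof -
    have "mtr m (mmul m (tder N \<sigma> n K) (X j)) =
       (\<Sum>p\<in>{..<N}\<times>{..<N}. K (fst p) (snd p) * Y0 j (snd p) (fst p))"
      by (subst tder_expand[OF N]) (simp add: mmul_sum_left mtr_sum Y0_def)
    also have "\<dots> = mtr N (mmul N K (Y0 j))"
      by (simp add: mtr_def mmul_def sum.cartesian_product split_def)
    finally show ?thesis by simp
  qed
  define c where "c j = mtr N (mmul N \<sigma> (Y0 j))" for j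
  have c: "cnj (c j) = c j" for j
    unfolding c_def mtr_adj[symmetric] adj_mmul Y0h \<sigma>h by (rule mtr_mmul_comm)
  \<comment> \<open>Centring makes the \<sigma>-mean zero, as the cancellation between different
    sites requires. It changes the functional only by a multiple of \<open>Tr K\<close>, hence not
    at all on traceless \<open>K\<close>.\<close>
  define Y where "Y j = (\<lambda>a b. Y0 j a b + (- c j) * mid a b)" for j
  have Yh: "adj (Y j) = Y j" for j
    using Y0h[of j] unfolding Y_def adj_add adj_scale by (auto simp: c adj_def mid_def fun_eq_iff)
  have YK: "mtr N (mmul N K (Y j)) = mtr N (mmul N K (Y0 j)) - c j * mtr N K" for K j
    unfolding Y_def mmul_add_right mmul_scale_right mtr_add mtr_scale mtr_mmul_mid by simp
  have Y1: "mtr N (mmul N K (Y j)) = mtr m (mmul m (tder N \<sigma> n K) (X j))" if "mtr N K = 0" for K j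
    using YK[of K j] that by (simp add: Y0)
  have \<sigma>Y: "mtr N (mmul N \<sigma> (Y j)) = 0" for j
    unfolding YK c_def[symmetric] using tr1 by (simp add: \<sigma>_def)
  have "Re (\<Sum>k\<in>UNIV. \<Sum>j\<in>UNIV. cnj (z k) * z j * mtr N (mmul N \<sigma> (mmul N (Y k) (Y j))))
       \<le> real n * Re (\<Sum>k\<in>UNIV. \<Sum>j\<in>UNIV. cnj (z k) * z j * V k j)" for z
  proof -
    define B where "B = (\<lambda>a b. \<Sum>j\<in>UNIV. z j * Y j a b)"
    have aB: "adj B = (\<lambda>a b. \<Sum>j\<in>UNIV. cnj (z j) * Y j a b)"
      unfolding B_def adj_sum Yh ..
    define q where "q = mtr N (mmul N \<sigma> (mmul N (adj B) B))"
    have q: "q = (\<Sum>k\<in>UNIV. \<Sum>j\<in>UNIV. cnj (z k) * z j * mtr N (mmul N \<sigma> (mmul N (Y k) (Y j))))"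
      unfolding q_def aB mmul_sum_left mmul_sum_right mtr_sum
      by (simp add: B_def mmul_sum_right mtr_sum sum_distrib_left mult.assoc)
    have \<sigma>B: "mtr N (mmul N \<sigma> B) = 0" "mtr N (mmul N \<sigma> (adj B)) = 0"
      unfolding aB by (simp_all add: B_def mmul_sum_right mtr_sum \<sigma>Y)
    \<comment> \<open>This is the sum over the sites of \<open>B\<close>, multiplied from the right
      by the tensor power of \<open>R\<close>.\<close>
    define T where "T = tder N R n (mmul N B R)"
    \<comment> \<open>For the multiple \<open>c T\<close> the last two terms of \<open>le\<close>
      are \<open>- 2 c Re q + c^2 n Re q\<close>. The choice \<open>c = 1/n\<close> minimises this
      expression when \<open>Re q\<close> is positive and leaves \<open>- Re q / n\<close>.\<close>
    define P where "P = (\<lambda>i j. complex_of_real (1 / n) * T i j)"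
    have aT: "adj T = tder N (adj R) n (mmul N (adj R) (adj B))"
      by (simp add: T_def adj_tder adj_mmul)
    have RB: "mmul N R (mmul N (adj R) (adj B)) = mmul N \<sigma> (adj B)"
      by (simp add: \<sigma>_def mmul_assoc)
    have "mtr m (mmul m (adj T) (mmul m (X j) (tpow N n R))) = mtr N (mmul N (mmul N \<sigma> (adj B)) (Y j))" for j
    proof -
      have "mtr m (mmul m (adj T) (mmul m (X j) (tpow N n R))) = mtr m (mmul m (mmul m (tpow N n R) (adj T)) (X j))"
        by (metis mmul_assoc mtr_mmul_comm)
      also have "mmul m (tpow N n R) (adj T) = tder N \<sigma> n (mmul N \<sigma> (adj B))"
        unfolding aT m_def tpow_mmul_tder RB by (simp add: \<sigma>_def)
      also have "mtr m (mmul m (tder N \<sigma> n (mmul N \<sigma> (adj B))) (X j)) = mtr N (mmul N (mmul N \<sigma> (adj B)) (Y j))"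
        using Y1[OF \<sigma>B(2)] by simp
      finally show ?thesis .
    qed
    then have cross: "(\<Sum>j\<in>UNIV. z j * mtr m (mmul m (adj T) (mmul m (X j) (tpow N n R)))) = q"
      by (simp add: q_def B_def mmul_sum_right mtr_sum mmul_assoc)
    have g1: "mtr N (mmul N (adj R) R) = 1" using tr1 by (simp add: mtr_mmul_comm)
    have g2: "mtr N (mmul N (adj R) (mmul N B R)) = 0"
    proof -
      have "mtr N (mmul N (adj R) (mmul N B R)) = mtr N (mmul N B \<sigma>)"
        unfolding mtr_mmul_comm[of N "adj R"] \<sigma>_def mmul_assoc ..
      then show ?thesis using \<sigma>B(1) by (simp add: mtr_mmul_comm[of N B])
    qed
    have "mtr m (mmul m (adj T) T) = of_nat n * mtr N (mmul N (adj (mmul N B R)) (mmul N B R))"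
      unfolding T_def m_def by (rule mtr_tder_gram[OF g1 g2])
    also have "mtr N (mmul N (adj (mmul N B R)) (mmul N B R)) = q"
      unfolding q_def \<sigma>_def adj_mmul mmul_assoc
      using mtr_mmul_comm[of N R "mmul N (adj R) (mmul N (adj B) B)"] by (simp add: mmul_assoc)
    finally have gram: "mtr m (mmul m (adj T) T) = of_nat n * q" .
    have aP: "adj P = (\<lambda>i j. complex_of_real (1 / n) * adj T i j)"
      unfolding P_def adj_scale by simp
    have c1: "(\<Sum>j\<in>UNIV. z j * mtr m (mmul m (adj P) (mmul m (X j) (tpow N n R)))) = complex_of_real (1 / n) * q"
      unfolding aP mmul_scale_left mtr_scale cross[symmetric] sum_distrib_left by (simp add: mult_ac)
    have c2: "mtr m (mmul m (adj P) P) = complex_of_real (1 / n) * q"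
      unfolding aP unfolding P_def mmul_scale_left mmul_scale_right mtr_scale gram using n by simp
    have "0 \<le> Re (\<Sum>k\<in>UNIV. \<Sum>j\<in>UNIV. cnj (z k) * z j * V k j) - 2 * Re (complex_of_real (1 / n) * q)
        + Re (complex_of_real (1 / n) * q)"
      using le[of z P] unfolding m_def[symmetric] c1 c2 .
    then have "Re q / n \<le> Re (\<Sum>k\<in>UNIV. \<Sum>j\<in>UNIV. cnj (z k) * z j * V k j)" by simp
    then show ?thesis unfolding q[symmetric] using n by (simp add: field_simps)
  qed
  then show thesis using that[of Y] Yh Y1 unfolding \<sigma>_def m_def by blast
qed

subsection \<open>Densities of operator-valued measures\<close>

lemma mtr_mmul_pairs:
  "mtr m (mmul m A C) = (\<Sum>p\<in>{..<m}\<times>{..<m}. C (snd p) (fst p) * A (fst p) (snd p))"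
  by (simp add: mtr_def mmul_def sum.cartesian_product split_def mult.commute)

lemma qform_eq_mtr: "qform m A v = mtr m (mmul m A (\<lambda>i j. v i * cnj (v j)))"
  by (simp add: qform_def mtr_def mmul_def mult_ac)

lemma set_integral_linear_combination:
  fixes f :: "'i \<Rightarrow> 'a \<Rightarrow> complex"
  assumes "\<And>i. i \<in> I \<Longrightarrow> integrable M (f i)" "A \<in> sets M"
  shows "(LINT x:A|M. (\<Sum>i\<in>I. c i * f i x)) = (\<Sum>i\<in>I. c i * (LINT x:A|M. f i x))"
proof -
  have "(LINT x:A|M. (\<Sum>i\<in>I. c i * f i x)) = (LINT x|M. (\<Sum>i\<in>I. c i * (indicator A x *\<^sub>R f i x)))"
    by (simp add: set_lebesgue_integral_def scaleR_sum_right)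
  also have "\<dots> = (\<Sum>i\<in>I. LINT x|M. c i * (indicator A x *\<^sub>R f i x))"
    by (rule Bochner_Integration.integral_sum)
      (intro integrable_mult_right integrable_mult_indicator assms)
  also have "\<dots> = (\<Sum>i\<in>I. c i * (LINT x|M. indicator A x *\<^sub>R f i x))"
    by (rule sum.cong[OF refl], rule integral_mult_right_zero)
  finally show ?thesis unfolding set_lebesgue_integral_def .
qed

lemma set_integral_Re:
  assumes "integrable M f" "A \<in> sets M"
  shows "(LINT x:A|M. Re (f x)) = Re (LINT x:A|M. f x)"
proof -
  have "integrable M (\<lambda>x. indicator A x *\<^sub>R f x)" by (intro integrable_mult_indicator assms)
  from integral_Re[OF this] show ?thesis by (simp add: set_lebesgue_integral_def)
qed

text \<open>The two indicators are added, unlike in \<open>qform_two\<close>, so that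
  \<open>a = b\<close> is covered and polarisation can treat diagonal and off-diagonal entries
  alike.\<close>

lemma qform_unit_sum:
  assumes "a < m" "b < m"
  shows "qform m A (\<lambda>k. (if k = a then 1 else 0) + (if k = b then c else 0)) =
    A a a + c * A a b + cnj c * A b a + cnj c * c * A b b"
proof -
  have cn: "cnj (\<Sum>k\<in>I. f k) = (\<Sum>k\<in>I. cnj (f k))" for I :: "nat set" and f by simp
  have s: "(\<Sum>j<m. F j * ((if j = a then 1 else 0) + (if j = b then c else 0))) = F a + F b * c" for F
    using assms by (simp add: distrib_left sum.distrib if_distrib[of "\<lambda>x. _ * x"] cong: if_cong)
  have s': "(\<Sum>j<m. cnj ((if j = a then 1 else 0) + (if j = b then c else 0)) * F j) = F a + cnj c * F b" for F
    using arg_cong[OF s[of "\<lambda>j. cnj (F j)"], of cnj] by (simp add: mult.commute)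
  show ?thesis
    unfolding qform_def s mult.assoc sum_distrib_left[symmetric] s' by (simp add: algebra_simps)
qed

text \<open>A POVM has a positive matrix-valued Radon-Nikodym density with respect to its trace; the entries
  of the density are recovered by polarisation from those of the scalar measures \<open>\<langle>v, M(\<cdot>) v\<rangle>\<close>.\<close>
lemma povm_density_exists:
  fixes M :: "(real^'d::finite) set \<Rightarrow> cmat"
  assumes M: "is_povm m M"
  obtains \<mu> :: "(real^'d) measure" and h :: "real^'d \<Rightarrow> cmat"
  where "finite_measure \<mu>" "sets \<mu> = sets borel" "\<And>x. adj (h x) = h x"
    "\<And>a b. a < m \<Longrightarrow> b < m \<Longrightarrow> integrable \<mu> (\<lambda>x. h x a b)"
    "AE x in \<mu>. psd m (h x) \<and> mtr m (h x) = 1"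
    "\<And>A a b. A \<in> sets borel \<Longrightarrow> a < m \<Longrightarrow> b < m \<Longrightarrow> (LINT x:A|\<mu>. h x a b) = M A a b"
proof -
  have psd: "psd m (M A)" if "A \<in> sets borel" for A using M that by (auto simp: is_povm_def)
  have her: "M A j i = cnj (M A i j)" if "A \<in> sets borel" "i < m" "j < m" for A i j
    using psd that unfolding psd_def hermitian_def by blast
  have ms: "measure_space UNIV (sets borel) (\<lambda>A. ennreal (Re (qform m (M A) v)))" for v
    using M unfolding is_povm_def by blast
  define \<nu> where "\<nu> v = measure_of UNIV (sets borel) (\<lambda>A. ennreal (Re (qform m (M A) v)))" for v
  have sets\<nu> [simp]: "sets (\<nu> v) = sets borel" and space\<nu> [simp]: "space (\<nu> v) = UNIV" for v
    using sets.sigma_sets_eq[of "borel :: (real^'d) measure"] by (simp_all add: \<nu>_def)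
  have em\<nu>: "emeasure (\<nu> v) A = ennreal (Re (qform m (M A) v))" if "A \<in> sets borel" for v A
    unfolding \<nu>_def emeasure_measure_of_conv
    using ms[of v] that sets.sigma_sets_eq[of "borel :: (real^'d) measure"] by simp
  have qnn: "0 \<le> Re (qform m (M A) v)" if "A \<in> sets borel" for A v
    using psd[OF that] by (simp add: psd_def)
  define e :: "nat \<Rightarrow> nat \<Rightarrow> complex" where "e k = (\<lambda>i. if i = k then 1 else 0)" for k
  have qe: "qform m (M A) (e k) = M A k k" if "k < m" for A k
    using qform_one[OF that, of "M A" 1] by (simp add: e_def)
  define \<mu> :: "(real^'d) measure"
    where "\<mu> = measure_of UNIV (sets borel) (\<lambda>A. \<Sum>k<m. emeasure (\<nu> (e k)) A)"
  have sets\<mu>: "sets \<mu> = sets borel" and space\<mu>: "space \<mu> = UNIV"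
    using sets.sigma_sets_eq[of "borel :: (real^'d) measure"] by (simp_all add: \<mu>_def)
  have em\<mu>: "emeasure \<mu> A = (\<Sum>k<m. emeasure (\<nu> (e k)) A)" if "A \<in> sets borel" for A
  proof (rule emeasure_measure_of[OF \<mu>_def])
    show "countably_additive (sets \<mu>) (\<lambda>A. \<Sum>k<m. emeasure (\<nu> (e k)) A)"
      unfolding countably_additive_def
    proof (intro allI impI)
      fix F :: "nat \<Rightarrow> (real^'d) set"
      assume F: "range F \<subseteq> sets \<mu>" "disjoint_family F"
      have "(\<Sum>i. \<Sum>k<m. emeasure (\<nu> (e k)) (F i)) = (\<Sum>k<m. \<Sum>i. emeasure (\<nu> (e k)) (F i))"
        by (rule suminf_sum) auto
      also have "\<dots> = (\<Sum>k<m. emeasure (\<nu> (e k)) (\<Union>i. F i))"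
        by (rule sum.cong[OF refl], rule suminf_emeasure) (use F sets\<mu> in auto)
      finally show "(\<Sum>i. \<Sum>k<m. emeasure (\<nu> (e k)) (F i)) = (\<Sum>k<m. emeasure (\<nu> (e k)) (\<Union>i. F i))" .
    qed
  qed (use that sets\<mu> in \<open>auto simp: positive_def\<close>)
  have em\<mu>': "emeasure \<mu> A = ennreal (Re (mtr m (M A)))" if "A \<in> sets borel" for A
  proof -
    have "emeasure \<mu> A = (\<Sum>k<m. ennreal (Re (M A k k)))"
      unfolding em\<mu>[OF that] by (rule sum.cong) (auto simp: em\<nu>[OF that] qe)
    also have "\<dots> = ennreal (\<Sum>k<m. Re (M A k k))"
      by (rule sum_ennreal) (use psd_diag[OF psd[OF that]] in auto)
    finally show ?thesis by (simp add: mtr_def)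
  qed
  have fin: "finite_measure \<mu>"
    by standard (simp add: space\<mu> em\<mu>')
  then interpret finite_measure \<mu> .
  have ex: "\<exists>D. integrable \<mu> D \<and> (\<forall>A\<in>sets borel. (LINT x:A|\<mu>. D x) = Re (qform m (M A) v))" for v
  proof -
    \<comment> \<open>Where the trace of the positive matrix \<open>M A\<close> vanishes, all its
      entries vanish, so the trace measure dominates each scalar measure.\<close>
    have ac: "absolutely_continuous \<mu> (\<nu> v)"
      unfolding absolutely_continuous_def
    proof
      fix A assume "A \<in> null_sets \<mu>"
      then have A: "A \<in> sets borel" and z: "emeasure \<mu> A = 0" by (auto simp: sets\<mu>)
      have "Re (mtr m (M A)) \<le> 0" using z em\<mu>'[OF A] by (simp add: ennreal_eq_0_iff)
      then have "M A i j = 0" if "i < m" "j < m" for i j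
        using psd_entry_le_trace[OF psd[OF A] that] norm_ge_zero[of "M A i j"]
        by (metis norm_le_zero_iff order_trans)
      then have "qform m (M A) v = 0" by (simp add: qform_def)
      then show "A \<in> null_sets (\<nu> v)" using A em\<nu>[OF A, of v] by (simp add: null_sets_def)
    qed
    have fv: "finite_measure (\<nu> v)" by standard (simp add: em\<nu>)
    have "sets (\<nu> v) = sets \<mu>" by (simp add: sets\<mu>)
    from real_RN_deriv[OF fv ac this] obtain D where
      D: "D \<in> borel_measurable \<mu>" "AE x in \<mu>. RN_deriv \<mu> (\<nu> v) x = ennreal (D x)" "\<And>x. 0 \<le> D x"
      by blast
    have nn: "(\<integral>\<^sup>+x. ennreal (D x * indicator A x) \<partial>\<mu>) = ennreal (Re (qform m (M A) v))"
      if A: "A \<in> sets borel" for A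
    proof -
      have "ennreal (Re (qform m (M A) v)) = emeasure (density \<mu> (RN_deriv \<mu> (\<nu> v))) A"
        using density_RN_deriv[OF ac] em\<nu>[OF A] sets\<mu> by simp
      also have "\<dots> = (\<integral>\<^sup>+x. RN_deriv \<mu> (\<nu> v) x * indicator A x \<partial>\<mu>)"
        by (rule emeasure_density) (use A sets\<mu> in auto)
      also have "\<dots> = (\<integral>\<^sup>+x. ennreal (D x * indicator A x) \<partial>\<mu>)"
        by (rule nn_integral_cong_AE) (use D(2) in \<open>eventually_elim, auto simp: indicator_def\<close>)
      finally show ?thesis by simp
    qed
    have "integrable \<mu> D"
      by (rule integrableI_nonneg) (use D nn[of UNIV] in \<open>auto simp: top.not_eq_extremum[symmetric]\<close>)
    moreover have "(LINT x:A|\<mu>. D x) = Re (qform m (M A) v)" if A: "A \<in> sets borel" for A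
    proof -
      have "(LINT x:A|\<mu>. D x) = enn2real (\<integral>\<^sup>+x. ennreal (D x * indicator A x) \<partial>\<mu>)"
        unfolding set_lebesgue_integral_def
        by (subst integral_eq_nn_integral) (use D A sets\<mu> in \<open>auto simp: mult.commute\<close>)
      then show ?thesis using nn[OF A] qnn[OF A] by simp
    qed
    ultimately show ?thesis by blast
  qed
  then obtain g where gi: "\<And>v. integrable \<mu> (g v)"
    and g: "\<And>v A. A \<in> sets borel \<Longrightarrow> (LINT x:A|\<mu>. g v x) = Re (qform m (M A) v)"
    by metis
  define S where "S a b c = (\<lambda>k. (if k = a then 1 else 0) + (if k = b then c else (0::complex)))" for a b :: nat and c
  have S1: "S a b 1 = S b a 1" for a b by (auto simp: S_def)
  \<comment> \<open>The functions \<open>g v\<close> are chosen separately for each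
    \<open>v\<close>, so relations between them hold only almost everywhere. Antisymmetrising the
    imaginary part makes \<open>h x\<close> self-adjoint at every point.\<close>
  define h :: "real^'d \<Rightarrow> cmat" where "h x = (\<lambda>a b. Complex
      ((g (S a b 1) x - g (e a) x - g (e b) x) / 2) ((g (S b a \<i>) x - g (S a b \<i>) x) / 4))" for x
  have h: "h x a b = (\<Sum>(c,v)\<leftarrow>[(1/2,S a b 1),(-1/2,e a),(-1/2,e b),(\<i>/4,S b a \<i>),(-\<i>/4,S a b \<i>)].
      c * complex_of_real (g v x))" for x a b
    by (simp add: h_def complex_eq_iff field_simps)
  have hadj: "adj (h x) = h x" for x
    by (auto simp: adj_def h_def complex_eq_iff S1 fun_eq_iff field_simps)
  have hint: "integrable \<mu> (\<lambda>x. h x a b)" for a b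
    unfolding h using gi by simp
  have hM: "(LINT x:A|\<mu>. h x a b) = M A a b" if A: "A \<in> sets borel" and ab: "a < m" "b < m" for A a b
  proof -
    have gi': "set_integrable \<mu> A (\<lambda>x. c * complex_of_real (g v x))" for c v
      unfolding set_integrable_def using A sets\<mu> gi[of v]
      by (intro integrable_mult_indicator) auto
    have gs: "(LINT x:A|\<mu>. c * complex_of_real (g v x)) = c * complex_of_real (Re (qform m (M A) v))" for c v
      by (simp only: set_integral_mult_right set_integral_complex_of_real g[OF A])
    have "(LINT x:A|\<mu>. h x a b) = (\<Sum>(c,v)\<leftarrow>[(1/2,S a b 1),(-1/2,e a),(-1/2,e b),(\<i>/4,S b a \<i>),(-\<i>/4,S a b \<i>)].
      c * complex_of_real (Re (qform m (M A) v)))"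
      unfolding h list.map sum_list.Cons sum_list.Nil split_conv
      by (simp only: set_integral_add gi' gs set_integral_add(1) add_0_right)
    also have "\<dots> = M A a b"
    proof -
      have r: "Re (M A b a) = Re (M A a b)" "Im (M A b a) = - Im (M A a b)"
        "Im (M A a a) = 0" "Im (M A b b) = 0"
        using her[OF A ab] psd_diag(2)[OF psd[OF A]] ab by auto
      have qS: "qform m (M A) (S k l c) = M A k k + c * M A k l + cnj c * M A l k + cnj c * c * M A l l"
        if "k < m" "l < m" for k l c
        unfolding S_def by (rule qform_unit_sum[OF that])
      show ?thesis
        using ab by (simp add: qS qe r complex_eq_iff field_simps)
    qed
    finally show ?thesis .
  qed
  have hC: "(LINT x:A|\<mu>. mtr m (mmul m (h x) C)) = mtr m (mmul m (M A) C)" if "A \<in> sets borel" for A C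
    unfolding mtr_mmul_pairs using that hint
    by (subst set_integral_linear_combination) (auto simp: sets\<mu> hM intro!: sum.cong)
  have hCint: "integrable \<mu> (\<lambda>x. mtr m (mmul m (h x) C))" for C
    unfolding mtr_mmul_pairs using hint by auto
  have pos: "AE x in \<mu>. 0 \<le> Re (qform m (h x) v)" for v
  proof (rule density_nonneg)
    show "integrable \<mu> (\<lambda>x. Re (qform m (h x) v))"
      unfolding qform_eq_mtr using hCint by simp
    fix A assume "A \<in> sets \<mu>"
    then have A: "A \<in> sets borel" by (simp add: sets\<mu>)
    have "(LINT x:A|\<mu>. Re (qform m (h x) v)) = Re (qform m (M A) v)"
      unfolding qform_eq_mtr by (subst set_integral_Re) (auto simp: hCint hC A sets\<mu>)
    then show "0 \<le> (LINT x:A|\<mu>. Re (qform m (h x) v))" using qnn[OF A] by simp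
  qed
  \<comment> \<open>Positivity holds outside a null set that depends on \<open>v\<close>. A
    countable dense set of vectors gives one common null set, and continuity of the quadratic form
    extends positivity to all \<open>v\<close>.\<close>
  obtain D :: "(nat \<Rightarrow> complex) set" where D: "countable D"
    and dense: "\<And>X. open X \<Longrightarrow> X \<noteq> {} \<Longrightarrow> \<exists>d\<in>D. d \<in> X"
    by (erule countable_dense_setE)
  have "AE x in \<mu>. \<forall>v\<in>D. 0 \<le> Re (qform m (h x) v)"
    using pos by (simp add: AE_ball_countable[OF D])
  then have psdh: "AE x in \<mu>. psd m (h x)"
  proof eventually_elim
    case (elim x)
    have "0 \<le> Re (qform m (h x) v)" for v
    proof (rule ccontr)
      assume n: "\<not> 0 \<le> Re (qform m (h x) v)"
      have "continuous_on UNIV (\<lambda>w. Re (qform m (h x) w))"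
        unfolding qform_def by (intro continuous_intros continuous_on_product_coordinates)
      then have "open {w. Re (qform m (h x) w) < 0}"
        by (intro open_Collect_less) auto
      moreover have "v \<in> {w. Re (qform m (h x) w) < 0}" using n by simp
      ultimately obtain d where "d \<in> D" "Re (qform m (h x) d) < 0" using dense by blast
      then show False using elim by fastforce
    qed
    then show ?case by (auto simp: psd_def hermitian_if_adj_eq hadj)
  qed
  have "AE x in \<mu>. mtr m (mmul m (h x) mid) = 1"
  proof (rule density_unique_banach)
    show "integrable \<mu> (\<lambda>x. mtr m (mmul m (h x) mid))" by (rule hCint)
    show "integrable \<mu> (\<lambda>x. 1::complex)" by simp
    fix A assume "A \<in> sets \<mu>"
    then have A: "A \<in> sets borel" by (simp add: sets\<mu>)
    have r: "mtr m (M A) = of_real (Re (mtr m (M A)))"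
      using psd_diag(2)[OF psd[OF A]] by (simp add: complex_eq_iff mtr_def)
    have "0 \<le> Re (mtr m (M A))"
      using psd_diag(1)[OF psd[OF A]] by (auto simp: mtr_def intro!: sum_nonneg)
    then have "measure \<mu> A = Re (mtr m (M A))" using em\<mu>'[OF A] by (simp add: measure_def)
    then have "(LINT x:A|\<mu>. 1) = mtr m (M A)"
      using r A by (simp add: set_lebesgue_integral_def sets\<mu> scaleR_conv_of_real)
    then show "(LINT x:A|\<mu>. mtr m (mmul m (h x) mid)) = (LINT x:A|\<mu>. 1)"
      unfolding hC[OF A] by (simp add: mtr_mmul_mid)
  qed
  then have "AE x in \<mu>. mtr m (h x) = 1" by (simp add: mtr_mmul_mid)
  with psdh have "AE x in \<mu>. psd m (h x) \<and> mtr m (h x) = 1" by eventually_elim simp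
  then show thesis
    using that[of \<mu> h] fin sets\<mu> hadj hint hM by blast
qed

lemma has_derivative_tpow:
  fixes \<rho> :: "'a::real_normed_vector \<Rightarrow> cmat"
  assumes N: "0 < N"
    and D: "\<And>i j. i < N \<Longrightarrow> j < N \<Longrightarrow> ((\<lambda>s. \<rho> s i j) has_derivative (\<lambda>v. D v i j)) (at t)"
  shows "i < N^n \<Longrightarrow> j < N^n \<Longrightarrow>
    ((\<lambda>s. tpow N n (\<rho> s) i j) has_derivative (\<lambda>v. tder N (\<rho> t) n (D v) i j)) (at t)"
proof (induction n arbitrary: i j)
  case 0
  then show ?case by simp
next
  case (Suc n)
  have "i div N < N^n" "j div N < N^n" "i mod N < N" "j mod N < N"
    using Suc.prems N by (auto simp: less_mult_imp_div_less mult.commute)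
  from has_derivative_mult[OF Suc.IH[OF this(1,2)] D[OF this(3,4)]]
  show ?case by (simp add: kron_def add.commute)
qed

text \<open>The square expanded pointwise, before integration in
  \<open>test_operator_inequality\<close>. The difference is written as a sum with the scalar
  \<open>-1\<close> so that the rules for sums and multiples suffice.\<close>

lemma Re_mtr_conjugate_diff:
  assumes h: "adj h = h"
  shows "Re (mtr m (mmul m (adj (\<lambda>i j. c * R i j + (-1) * P i j)) (mmul m h (\<lambda>i j. c * R i j + (-1) * P i j))))
    = (cmod c)\<^sup>2 * Re (mtr m (mmul m h (mmul m R (adj R)))) - 2 * Re (c * mtr m (mmul m h (mmul m R (adj P))))
      + Re (mtr m (mmul m h (mmul m P (adj P))))"
proof -
  have "mtr m (mmul m (adj R) (mmul m h P)) = cnj (mtr m (mmul m (adj P) (mmul m h R)))"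
    unfolding mtr_adj[symmetric] adj_mmul adj_adj h mmul_assoc ..
  then have x: "Re (cnj c * mtr m (mmul m (adj R) (mmul m h P))) = Re (c * mtr m (mmul m (adj P) (mmul m h R)))"
    by simp
  show ?thesis
    unfolding adj_add adj_scale mmul_add_left mmul_add_right mmul_scale_left mmul_scale_right mtr_add mtr_scale
      mtr_mmul_rotate[of m h]
    using x by (simp add: cmod_power2 mtr_mmul_rotate[of m R "adj R"] mtr_mmul_rotate[of m R "adj P"]
        mtr_mmul_rotate[of m P "adj P"]) (simp add: power2_eq_square algebra_simps)
qed

section \<open>Operator moments and outcome laws of a POVM\<close>

locale povm_density =
  fixes m :: nat and M :: "(real^'d::finite) set \<Rightarrow> cmat" and \<mu> :: "(real^'d) measure"
    and h :: "real^'d \<Rightarrow> cmat"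
  assumes fin: "finite_measure \<mu>" and sets_eq: "sets \<mu> = sets borel"
    and adj_h: "\<And>x. adj (h x) = h x"
    and int_h: "\<And>a b. a < m \<Longrightarrow> b < m \<Longrightarrow> integrable \<mu> (\<lambda>x. h x a b)"
    and psd_h: "AE x in \<mu>. psd m (h x) \<and> mtr m (h x) = 1"
    and set_int_h: "\<And>A a b. A \<in> sets borel \<Longrightarrow> a < m \<Longrightarrow> b < m \<Longrightarrow> (LINT x:A|\<mu>. h x a b) = M A a b"
    and M_UNIV: "meq m (M UNIV) mid"
begin

lemma space_eq: "space \<mu> = UNIV"
  using sets_eq_imp_space_eq[OF sets_eq] by simp

lemma measurable_eq: "borel_measurable \<mu> = borel_measurable borel"
  by (rule measurable_cong_sets) (simp_all add: sets_eq)

text \<open>The operator integral of \<phi> against \<open>M\<close>, formed entry by entry through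
  the density.\<close>

definition moment :: "(real^'d \<Rightarrow> complex) \<Rightarrow> cmat" where
  "moment \<phi> = (\<lambda>a b. LINT x|\<mu>. \<phi> x * h x a b)"

text \<open>The entries of a positive matrix of trace one have modulus at most one, so \<phi> itself
  is a majorant.\<close>

lemma integrable_times:
  assumes \<phi>: "integrable \<mu> \<phi>" and ab: "a < m" "b < m"
  shows "integrable \<mu> (\<lambda>x. \<phi> x * h x a b)"
proof (rule Bochner_Integration.integrable_bound[OF \<phi>])
  show "(\<lambda>x. \<phi> x * h x a b) \<in> borel_measurable \<mu>"
    using \<phi> int_h[OF ab] by (intro borel_measurable_times borel_measurable_integrable)
  show "AE x in \<mu>. norm (\<phi> x * h x a b) \<le> norm (\<phi> x)"
    using psd_h
  proof eventually_elim
    case (elim x)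
    then have "cmod (h x a b) \<le> 1" using psd_entry_le_trace[of m "h x" a b] ab by simp
    then show ?case by (simp add: norm_mult mult_left_le)
  qed
qed

lemma integrable_mtr:
  assumes \<phi>: "integrable \<mu> \<phi>"
  shows "integrable \<mu> (\<lambda>x. \<phi> x * mtr m (mmul m (h x) C))"
proof -
  have "integrable \<mu> (\<lambda>x. \<Sum>p\<in>{..<m}\<times>{..<m}. C (snd p) (fst p) * (\<phi> x * h x (fst p) (snd p)))"
    by (intro Bochner_Integration.integrable_sum integrable_mult_right integrable_times \<phi>) auto
  then show ?thesis by (simp add: mtr_mmul_pairs sum_distrib_left mult_ac)
qed

lemma integral_mtr:
  assumes \<phi>: "integrable \<mu> \<phi>"
  shows "(LINT x|\<mu>. \<phi> x * mtr m (mmul m (h x) C)) = mtr m (mmul m (moment \<phi>) C)"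
proof -
  have "(LINT x|\<mu>. \<phi> x * mtr m (mmul m (h x) C)) =
      (LINT x|\<mu>. (\<Sum>p\<in>{..<m}\<times>{..<m}. C (snd p) (fst p) * (\<phi> x * h x (fst p) (snd p))))"
    by (simp add: mtr_mmul_pairs sum_distrib_left mult_ac)
  also have "\<dots> = (\<Sum>p\<in>{..<m}\<times>{..<m}. LINT x|\<mu>. C (snd p) (fst p) * (\<phi> x * h x (fst p) (snd p)))"
    by (intro Bochner_Integration.integral_sum integrable_mult_right integrable_times \<phi>) auto
  also have "\<dots> = mtr m (mmul m (moment \<phi>) C)"
    by (simp add: mtr_mmul_pairs moment_def)
  finally show ?thesis .
qed

lemma integrable_one: "integrable \<mu> (\<lambda>x. 1 :: complex)"
  using finite_measure.integrable_const[OF fin] by blast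

lemma moment_one: "meq m (moment (\<lambda>x. 1)) mid"
  using M_UNIV set_int_h[of UNIV] by (simp add: meq_def moment_def set_lebesgue_integral_def)

lemma integral_mtr_one: "(LINT x|\<mu>. mtr m (mmul m (h x) C)) = mtr m C"
proof -
  have "(LINT x|\<mu>. mtr m (mmul m (h x) C)) = mtr m (mmul m (moment (\<lambda>x. 1)) C)"
    using integral_mtr[OF integrable_one, of C] by simp
  also have "\<dots> = mtr m (mmul m mid C)"
    by (intro mtr_cong mmul_cong moment_one meq_refl)
  also have "\<dots> = mtr m C" by (rule mtr_cong[OF mmul_mid(2)])
  finally show ?thesis .
qed

lemma adj_moment: "adj (moment (\<lambda>x. complex_of_real (\<phi> x))) = moment (\<lambda>x. complex_of_real (\<phi> x))"
proof (intro ext)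
  fix a b
  have h: "cnj (h x b a) = h x a b" for x using adj_h[of x] by (metis adj_def)
  have "adj (moment (\<lambda>x. complex_of_real (\<phi> x))) a b = (LINT x|\<mu>. cnj (complex_of_real (\<phi> x) * h x b a))"
    unfolding adj_def moment_def by (rule Bochner_Integration.integral_cnj[symmetric])
  then show "adj (moment (\<lambda>x. complex_of_real (\<phi> x))) a b = moment (\<lambda>x. complex_of_real (\<phi> x)) a b"
    by (simp add: h moment_def)
qed

lemma moment_sum:
  assumes \<phi>: "\<And>j. j \<in> I \<Longrightarrow> integrable \<mu> (\<phi> j)"
  shows "meq m (moment (\<lambda>x. \<Sum>j\<in>I. z j * \<phi> j x)) (\<lambda>a b. \<Sum>j\<in>I. z j * moment (\<phi> j) a b)"
  unfolding meq_def
proof (intro allI impI)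
  fix a b assume ab: "a < m" "b < m"
  have "moment (\<lambda>x. \<Sum>j\<in>I. z j * \<phi> j x) a b = (LINT x|\<mu>. (\<Sum>j\<in>I. z j * (\<phi> j x * h x a b)))"
    by (simp add: moment_def sum_distrib_right mult.assoc)
  also have "\<dots> = (\<Sum>j\<in>I. LINT x|\<mu>. z j * (\<phi> j x * h x a b))"
    by (intro Bochner_Integration.integral_sum integrable_mult_right integrable_times \<phi> ab)
  finally show "moment (\<lambda>x. \<Sum>j\<in>I. z j * \<phi> j x) a b = (\<Sum>j\<in>I. z j * moment (\<phi> j) a b)"
    by (simp add: moment_def)
qed

definition dens :: "cmat \<Rightarrow> real^'d \<Rightarrow> real" where
  "dens \<sigma> x = Re (mtr m (mmul m (h x) \<sigma>))"

lemma dens_cong: "meq m \<sigma> \<sigma>' \<Longrightarrow> dens \<sigma> = dens \<sigma>'"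
  unfolding dens_def by (intro ext arg_cong[of _ _ Re] mtr_cong mmul_cong meq_refl)

lemma integrable_dens: "integrable \<mu> (dens \<sigma>)"
  using integrable_mtr[OF integrable_one, of \<sigma>] by (auto simp: dens_def[abs_def])

lemma dens_nonneg: "AE x in \<mu>. 0 \<le> dens (mmul m R (adj R)) x"
  using psd_h
proof eventually_elim
  case (elim x)
  then show ?case
    using psd_conjugate_trace_nonneg[of m "h x" "R"]
    by (simp add: dens_def mtr_mmul_rotate[of m "adj R"])
qed

text \<open>An invertible factor makes the state strictly positive, so \<mu> is dominated by a
  constant times the outcome law. The constant is that of \<open>trace_le_trace_conjugate\<close>,
  applied to \<open>h x\<close> with trace one.\<close>

lemma dens_bounded_below:
  assumes "meq m (mmul m R Q) mid"
  shows "\<exists>K\<ge>0. AE x in \<mu>. 1 \<le> K * dens (mmul m R (adj R)) x"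
proof (intro exI conjI)
  show "0 \<le> (\<Sum>i<m. \<Sum>j<m. cmod (mmul m Q (adj Q) j i))" by (intro sum_nonneg) auto
  show "AE x in \<mu>. 1 \<le> (\<Sum>i<m. \<Sum>j<m. cmod (mmul m Q (adj Q) j i)) * dens (mmul m R (adj R)) x"
    using psd_h
  proof eventually_elim
    case (elim x)
    then show ?case
      using trace_le_trace_conjugate[of m "h x" R Q] assms adj_h[of x] by (simp add: dens_def)
  qed
qed

text \<open>\<open>ennreal\<close> truncates negative values, so integrating the density reproduces
  the set function of \<open>outcome\<close> once the density is nonnegative almost
  everywhere.\<close>

lemma outcome_eq_density:
  assumes nn: "AE x in \<mu>. 0 \<le> dens \<sigma> x"
  shows "outcome m M \<sigma> = density \<mu> (\<lambda>x. ennreal (dens \<sigma> x))"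
proof -
  let ?D = "density \<mu> (\<lambda>x. ennreal (dens \<sigma> x))"
  have meas: "dens \<sigma> \<in> borel_measurable \<mu>" using integrable_dens by (rule borel_measurable_integrable)
  have em: "emeasure ?D A = ennreal (Re (mtr m (mmul m (M A) \<sigma>)))" if A: "A \<in> sets borel" for A
  proof -
    have A': "A \<in> sets \<mu>" using A by (simp add: sets_eq)
    have i: "integrable \<mu> (\<lambda>x. mtr m (mmul m (h x) \<sigma>))"
      using integrable_mtr[OF integrable_one] by simp
    have "emeasure ?D A = (\<integral>\<^sup>+x. ennreal (dens \<sigma> x) * indicator A x \<partial>\<mu>)"
      by (rule emeasure_density) (use meas A' in auto)
    also have "\<dots> = (\<integral>\<^sup>+x. ennreal (indicator A x *\<^sub>R dens \<sigma> x) \<partial>\<mu>)"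
      by (rule nn_integral_cong) (auto simp: indicator_def)
    also have "\<dots> = ennreal (LINT x:A|\<mu>. dens \<sigma> x)"
      unfolding set_lebesgue_integral_def
    proof (rule nn_integral_eq_integral)
      show "integrable \<mu> (\<lambda>x. indicator A x *\<^sub>R dens \<sigma> x)"
        by (intro integrable_mult_indicator integrable_dens A')
      show "AE x in \<mu>. 0 \<le> indicator A x *\<^sub>R dens \<sigma> x"
        using nn by eventually_elim (simp add: indicator_def)
    qed
    also have "(LINT x:A|\<mu>. dens \<sigma> x) = Re (LINT x:A|\<mu>. mtr m (mmul m (h x) \<sigma>))"
      unfolding dens_def by (rule set_integral_Re[OF i A'])
    also have "(LINT x:A|\<mu>. mtr m (mmul m (h x) \<sigma>)) = mtr m (mmul m (M A) \<sigma>)"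
      unfolding mtr_mmul_pairs using A int_h
      by (subst set_integral_linear_combination) (auto simp: sets_eq set_int_h intro!: sum.cong)
    finally show ?thesis .
  qed
  have "outcome m M \<sigma> = measure_of UNIV (sets borel) (emeasure ?D)"
    unfolding outcome_def
  proof (rule measure_of_eq)
    fix A :: "(real^'d) set" assume "A \<in> sigma_sets UNIV (sets borel)"
    then have "A \<in> sets borel" using sets.sigma_sets_eq[of "borel :: (real^'d) measure"] by simp
    then show "ennreal (Re (mtr m (mmul m (M A) \<sigma>))) = emeasure ?D A" by (simp add: em)
  qed simp
  also have "\<dots> = ?D"
    using measure_of_of_measure[of ?D] by (simp add: space_eq sets_eq)
  finally show ?thesis .
qed

lemma integral_outcome:
  fixes f :: "real^'d \<Rightarrow> real"
  assumes "AE x in \<mu>. 0 \<le> dens \<sigma> x" "f \<in> borel_measurable borel"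
  shows "integral\<^sup>L (outcome m M \<sigma>) f = (LINT x|\<mu>. dens \<sigma> x * f x)"
    and "integrable (outcome m M \<sigma>) f \<longleftrightarrow> integrable \<mu> (\<lambda>x. dens \<sigma> x * f x)"
proof -
  have f: "f \<in> borel_measurable \<mu>" using assms(2) by (simp add: measurable_eq)
  have d: "dens \<sigma> \<in> borel_measurable \<mu>" using integrable_dens by (rule borel_measurable_integrable)
  show "integral\<^sup>L (outcome m M \<sigma>) f = (LINT x|\<mu>. dens \<sigma> x * f x)"
    unfolding outcome_eq_density[OF assms(1)] using integral_density[OF f d assms(1)] by simp
  show "integrable (outcome m M \<sigma>) f \<longleftrightarrow> integrable \<mu> (\<lambda>x. dens \<sigma> x * f x)"
    unfolding outcome_eq_density[OF assms(1)] using integrable_density[OF f d assms(1)] by simp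
qed

text \<open>Square integrability is moved from the outcome law in one state to \<mu>, which does not
  depend on the state. The operator moments obtained from it then serve all parameters at
  once.\<close>

lemma integrable_coordinate_products:
  assumes inv: "meq m (mmul m R Q) mid"
    and L2: "\<And>j. integrable (outcome m M (mmul m R (adj R))) (\<lambda>x. (x $ j)\<^sup>2)"
  shows "integrable \<mu> (\<lambda>x. x $ j)" "integrable \<mu> (\<lambda>x. (x $ k - t $ k) * (x $ j - t $ j))"
proof -
  interpret finite_measure \<mu> by (rule fin)
  have c: "(\<lambda>x. x $ j) \<in> borel_measurable \<mu>" for j
    unfolding measurable_eq by simp
  have sq: "integrable \<mu> (\<lambda>x. (x $ j)\<^sup>2)" for j
  proof -
    obtain K where K: "0 \<le> K" "AE x in \<mu>. 1 \<le> K * dens (mmul m R (adj R)) x"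
      using dens_bounded_below[OF inv] by blast
    have i: "integrable \<mu> (\<lambda>x. K * (dens (mmul m R (adj R)) x * (x $ j)\<^sup>2))"
      using L2[of j] integral_outcome(2)[OF dens_nonneg] by auto
    show ?thesis
    proof (rule Bochner_Integration.integrable_bound[OF i])
      show "(\<lambda>x. (x $ j)\<^sup>2) \<in> borel_measurable \<mu>" using c[of j] by measurable
      show "AE x in \<mu>. norm ((x $ j)\<^sup>2) \<le> norm (K * (dens (mmul m R (adj R)) x * (x $ j)\<^sup>2))"
        using K(2)
      proof eventually_elim
        case (elim x)
        have "(x $ j)\<^sup>2 \<le> (K * dens (mmul m R (adj R)) x) * (x $ j)\<^sup>2"
          using mult_right_mono[OF elim, of "(x $ j)\<^sup>2"] by simp
        also have "\<dots> \<le> \<bar>(K * dens (mmul m R (adj R)) x) * (x $ j)\<^sup>2\<bar>" by simp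
        finally show ?case by (simp add: mult.assoc)
      qed
    qed
  qed
  show i1: "integrable \<mu> (\<lambda>x. x $ j)" for j
  proof (rule Bochner_Integration.integrable_bound)
    show "integrable \<mu> (\<lambda>x. 1 + (x $ j)\<^sup>2)" using sq by simp
    show "AE x in \<mu>. norm (x $ j) \<le> norm (1 + (x $ j)\<^sup>2)"
    proof (rule AE_I2)
      fix x :: "real^'d"
      have "0 \<le> (\<bar>x $ j\<bar> - 1)\<^sup>2" by simp
      then have "2 * \<bar>x $ j\<bar> \<le> 1 + (x $ j)\<^sup>2" by (simp add: power2_diff)
      then show "norm (x $ j) \<le> norm (1 + (x $ j)\<^sup>2)" by simp
    qed
  qed (rule c)
  have i2: "integrable \<mu> (\<lambda>x. x $ k * x $ j)"
  proof (rule Bochner_Integration.integrable_bound)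
    show "integrable \<mu> (\<lambda>x. (x $ k)\<^sup>2 + (x $ j)\<^sup>2)" using sq by simp
    show "(\<lambda>x. x $ k * x $ j) \<in> borel_measurable \<mu>" using c by measurable
    show "AE x in \<mu>. norm (x $ k * x $ j) \<le> norm ((x $ k)\<^sup>2 + (x $ j)\<^sup>2)"
    proof (rule AE_I2)
      fix x :: "real^'d"
      have "0 \<le> (\<bar>x $ k\<bar> - \<bar>x $ j\<bar>)\<^sup>2" by simp
      then have "2 * (\<bar>x $ k\<bar> * \<bar>x $ j\<bar>) \<le> (x $ k)\<^sup>2 + (x $ j)\<^sup>2" by (simp add: power2_diff)
      moreover have "0 \<le> \<bar>x $ k\<bar> * \<bar>x $ j\<bar>" by simp
      ultimately have "\<bar>x $ k\<bar> * \<bar>x $ j\<bar> \<le> (x $ k)\<^sup>2 + (x $ j)\<^sup>2" by linarith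
      then show "norm (x $ k * x $ j) \<le> norm ((x $ k)\<^sup>2 + (x $ j)\<^sup>2)" by (simp add: abs_mult)
    qed
  qed
  have "integrable \<mu> (\<lambda>x. x $ k * x $ j - t $ j * x $ k - t $ k * x $ j + t $ k * t $ j)"
    using i1 i2 by simp
  then show "integrable \<mu> (\<lambda>x. (x $ k - t $ k) * (x $ j - t $ j))"
    by (simp add: algebra_simps)
qed

text \<open>The state enters only through a trace against a fixed operator, so the mean can be
  differentiated without interchanging derivative and integral. Centring at \<open>c\<close> is free
  because \<open>Tr \<sigma> = 1\<close>.\<close>

lemma expect_eq:
  assumes nn: "AE x in \<mu>. 0 \<le> dens \<sigma> x" and tr: "mtr m \<sigma> = 1" and i: "integrable \<mu> (\<lambda>x. x $ j)"
  shows "expect m M \<sigma> $ j = c + Re (mtr m (mmul m (moment (\<lambda>x. complex_of_real (x $ j - c))) \<sigma>))"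
proof -
  interpret finite_measure \<mu> by (rule fin)
  have i': "integrable \<mu> (\<lambda>x. complex_of_real (x $ j))" using i by simp
  have i'': "integrable \<mu> (\<lambda>x. complex_of_real (x $ j - c))" using i by simp
  have id: "integrable \<mu> (\<lambda>x. dens \<sigma> x * (x $ j - c))"
    using integrable_Re[OF integrable_mtr[OF i'', of \<sigma>]] by (simp add: dens_def mult.commute)
  have "expect m M \<sigma> $ j = (LINT x|\<mu>. dens \<sigma> x * x $ j)"
    unfolding expect_def using integral_outcome(1)[OF nn, of "\<lambda>x. x $ j"] by simp
  also have "\<dots> = (LINT x|\<mu>. c * dens \<sigma> x + dens \<sigma> x * (x $ j - c))"
    by (simp add: algebra_simps)
  also have "\<dots> = c * (LINT x|\<mu>. dens \<sigma> x) + (LINT x|\<mu>. dens \<sigma> x * (x $ j - c))"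
    by (subst Bochner_Integration.integral_add) (use integrable_dens id in auto)
  also have "(LINT x|\<mu>. dens \<sigma> x) = 1"
  proof -
    have "integrable \<mu> (\<lambda>x. mtr m (mmul m (h x) \<sigma>))" using integrable_mtr[OF integrable_one] by simp
    from integral_Re[OF this] show ?thesis by (simp add: dens_def integral_mtr_one tr)
  qed
  also have "(LINT x|\<mu>. dens \<sigma> x * (x $ j - c)) = Re (mtr m (mmul m (moment (\<lambda>x. complex_of_real (x $ j - c))) \<sigma>))"
    using integral_Re[OF integrable_mtr[OF i'', of \<sigma>]]
    unfolding integral_mtr[OF i''] by (simp add: dens_def mult.commute)
  finally show ?thesis by simp
qed

text \<open>Integrate the nonnegative trace of \<open>adj (\<phi> R - P) h (\<phi> R - P)\<close>
  over \<mu>; in the last term the density integrates to the identity.\<close>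

lemma test_operator_inequality:
  assumes \<phi>: "integrable \<mu> \<phi>" and \<phi>2: "integrable \<mu> (\<lambda>x. (cmod (\<phi> x))\<^sup>2 * dens (mmul m R (adj R)) x)"
  shows "0 \<le> (LINT x|\<mu>. (cmod (\<phi> x))\<^sup>2 * dens (mmul m R (adj R)) x)
     - 2 * Re (mtr m (mmul m (adj P) (mmul m (moment \<phi>) R))) + Re (mtr m (mmul m (adj P) P))"
proof -
  let ?f = "\<lambda>x. (cmod (\<phi> x))\<^sup>2 * dens (mmul m R (adj R)) x"
  let ?g = "\<lambda>x. Re (\<phi> x * mtr m (mmul m (h x) (mmul m R (adj P))))"
  let ?k = "\<lambda>x. Re (mtr m (mmul m (h x) (mmul m P (adj P))))"
  have g: "integrable \<mu> ?g" using integrable_Re[OF integrable_mtr[OF \<phi>]] .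
  have k: "integrable \<mu> ?k" using integrable_Re[OF integrable_mtr[OF integrable_one]] by simp
  have "0 \<le> (LINT x|\<mu>. ?f x - 2 * ?g x + ?k x)"
  proof (rule integral_nonneg_AE)
    show "AE x in \<mu>. 0 \<le> ?f x - 2 * ?g x + ?k x"
      using psd_h
    proof eventually_elim
      case (elim x)
      then show ?case
        using psd_conjugate_trace_nonneg[of m "h x" "\<lambda>i j. \<phi> x * R i j + (-1) * P i j"]
        unfolding Re_mtr_conjugate_diff[OF adj_h] dens_def by simp
    qed
  qed
  also have "\<dots> = (LINT x|\<mu>. ?f x) - 2 * (LINT x|\<mu>. ?g x) + (LINT x|\<mu>. ?k x)"
    using \<phi>2 g k
    by (simp only: Bochner_Integration.integral_add Bochner_Integration.integral_diff
        Bochner_Integration.integrable_diff integrable_mult_right integral_mult_right_zero)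
  also have "(LINT x|\<mu>. ?g x) = Re (mtr m (mmul m (moment \<phi>) (mmul m R (adj P))))"
    using integral_Re[OF integrable_mtr[OF \<phi>]] unfolding integral_mtr[OF \<phi>] .
  also have "(LINT x|\<mu>. ?k x) = Re (mtr m (mmul m P (adj P)))"
    using integral_Re[OF integrable_mtr[OF integrable_one, of "mmul m P (adj P)"]] integral_mtr_one by simp
  finally show ?thesis
    by (simp add: mtr_mmul_comm[of m P] mtr_mmul_rotate[of m "adj P"])
qed

end

section \<open>Single-copy operators attached to an estimator on \<open>n\<close> copies\<close>

lemma single_copy_operators:
  fixes \<rho> :: "real^'d::finite \<Rightarrow> cmat" and M :: "(real^'d) set \<Rightarrow> cmat"
  assumes model: "qmodel N \<Theta> \<rho>" and t: "t \<in> \<Theta>" and n: "0 < n" and povm: "is_povm (N^n) M"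
    and L2: "\<And>j. integrable (outcome (N^n) M (tpow N n (\<rho> t))) (\<lambda>x. (x $ j)\<^sup>2)"
  obtains Y :: "'d \<Rightarrow> cmat" where "\<And>j. adj (Y j) = Y j"
    and "\<And>k j. mtr N (mmul N (drho \<rho> t k) (Y j))
      = of_real (pderiv_at k (\<lambda>s. expect (N^n) M (tpow N n (\<rho> s)) $ j) t)"
    and "\<And>z. Re (\<Sum>k\<in>UNIV. \<Sum>j\<in>UNIV. cnj (z k) * z j * mtr N (mmul N (\<rho> t) (mmul N (Y k) (Y j))))
      \<le> real n * Re (\<Sum>k\<in>UNIV. \<Sum>j\<in>UNIV. cnj (z k) * z j * of_real (mse (N^n) M (tpow N n (\<rho> t)) t $ k $ j))"
proof -
  define m where "m = N^n"
  have N: "0 < N" and op: "open \<Theta>" and sd: "\<And>s. s \<in> \<Theta> \<Longrightarrow> strict_density N (\<rho> s)"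
    and sm: "\<And>i j. i < N \<Longrightarrow> j < N \<Longrightarrow> smooth_on \<Theta> (\<lambda>s. \<rho> s i j)"
    using model by (auto simp: qmodel_def)
  \<comment> \<open>Factors are chosen at every parameter and not only at \<open>t\<close>: the
    formula for the mean must hold on a neighbourhood before it can be differentiated.\<close>
  have "\<exists>R Q. meq N (\<rho> s) (mmul N R (adj R)) \<and> meq N (mmul N R Q) mid" if "s \<in> \<Theta>" for s
    using pos_def_factor[of N "\<rho> s"] sd[OF that] unfolding strict_density_def by blast
  then obtain R Q where R: "\<And>s. s \<in> \<Theta> \<Longrightarrow> meq N (\<rho> s) (mmul N (R s) (adj (R s)))"
    and Q: "\<And>s. s \<in> \<Theta> \<Longrightarrow> meq N (mmul N (R s) (Q s)) mid"
    by metis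
  have tr\<rho>: "mtr N (\<rho> s) = 1" if "s \<in> \<Theta>" for s using sd[OF that] by (simp add: strict_density_def)
  define Rn where "Rn s = tpow N n (R s)" for s
  have tp: "meq m (tpow N n (\<rho> s)) (mmul m (Rn s) (adj (Rn s)))" if "s \<in> \<Theta>" for s
    unfolding Rn_def m_def adj_tpow tpow_mmul by (rule tpow_cong[OF R[OF that]])
  have inv: "meq m (mmul m (Rn s) (tpow N n (Q s))) mid" if "s \<in> \<Theta>" for s
    unfolding Rn_def m_def tpow_mmul using meq_trans[OF tpow_cong[OF Q[OF that]] tpow_mid] .
  have trm: "mtr m (tpow N n (\<rho> s)) = 1" if "s \<in> \<Theta>" for s
    by (simp add: m_def mtr_tpow tr\<rho>[OF that])
  obtain \<mu> :: "(real^'d) measure" and h where dens: "povm_density m M \<mu> h"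
  proof -
    from povm_density_exists[OF povm[folded m_def]] obtain \<mu> :: "(real^'d) measure" and h where
      "finite_measure \<mu>" "sets \<mu> = sets borel" "\<And>x. adj (h x) = h x"
      "\<And>a b. a < m \<Longrightarrow> b < m \<Longrightarrow> integrable \<mu> (\<lambda>x. h x a b)"
      "AE x in \<mu>. psd m (h x) \<and> mtr m (h x) = 1"
      "\<And>A a b. A \<in> sets borel \<Longrightarrow> a < m \<Longrightarrow> b < m \<Longrightarrow> (LINT x:A|\<mu>. h x a b) = M A a b"
      by blast
    moreover have "meq m (M UNIV) mid" using povm by (simp add: is_povm_def m_def)
    ultimately have "povm_density m M \<mu> h" by (simp add: povm_density_def)
    then show thesis by (rule that)
  qed
  interpret povm_density m M \<mu> h by (rule dens)
  have dn: "dens (tpow N n (\<rho> s)) = dens (mmul m (Rn s) (adj (Rn s)))" if "s \<in> \<Theta>" for s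
    by (rule dens_cong[OF tp[OF that]])
  have nn: "AE x in \<mu>. 0 \<le> dens (tpow N n (\<rho> s)) x" if "s \<in> \<Theta>" for s
    unfolding dn[OF that] by (rule dens_nonneg)
  have L2': "integrable (outcome m M (mmul m (Rn t) (adj (Rn t)))) (\<lambda>x. (x $ j)\<^sup>2)" for j
    using L2[of j] unfolding m_def[symmetric] outcome_eq_density[OF nn[OF t]]
      outcome_eq_density[OF dens_nonneg] dn[OF t] .
  note i1 = integrable_coordinate_products(1)[OF inv[OF t] L2']
  note i2 = integrable_coordinate_products(2)[OF inv[OF t] L2', where t = t]
  define \<phi> where "\<phi> j x = complex_of_real (x $ j - t $ j)" for j and x :: "real^'d"
  have i\<phi>: "integrable \<mu> (\<phi> j)" for j
  proof -
    interpret finite_measure \<mu> by (rule fin)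
    show ?thesis unfolding \<phi>_def[abs_def] using i1 by simp
  qed
  define X where "X j = moment (\<phi> j)" for j
  have Xh: "adj (X j) = X j" for j
    unfolding X_def \<phi>_def[abs_def] by (rule adj_moment)
  have ex: "expect m M (tpow N n (\<rho> s)) $ j = t $ j + Re (mtr m (mmul m (X j) (tpow N n (\<rho> s))))"
    if "s \<in> \<Theta>" for s j
    unfolding X_def \<phi>_def[abs_def] by (rule expect_eq[OF nn[OF that] trm[OF that] i1])

  define V where "V k j = complex_of_real (mse m M (tpow N n (\<rho> t)) t $ k $ j)" for k j
  have le: "0 \<le> Re (\<Sum>k\<in>UNIV. \<Sum>j\<in>UNIV. cnj (z k) * z j * V k j)
        - 2 * Re (\<Sum>j\<in>UNIV. z j * mtr m (mmul m (adj P) (mmul m (X j) (tpow N n (R t)))))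
        + Re (mtr m (mmul m (adj P) P))" for z P
  proof -
    define \<psi> where "\<psi> x = (\<Sum>j\<in>UNIV. z j * \<phi> j x)" for x
    let ?d = "dens (mmul m (Rn t) (adj (Rn t)))"
    let ?e = "\<lambda>k j x. ?d x * ((x $ k - t $ k) * (x $ j - t $ j))"
    have i\<psi>: "integrable \<mu> \<psi>"
      unfolding \<psi>_def[abs_def] by (intro Bochner_Integration.integrable_sum integrable_mult_right i\<phi>)
    have ie: "integrable \<mu> (?e k j)" for k j
    proof -
      have "integrable \<mu> (\<lambda>x. complex_of_real ((x $ k - t $ k) * (x $ j - t $ j)))"
        using i2[of k j] by (simp del: of_real_mult of_real_diff)
      from integrable_Re[OF integrable_mtr[OF this, of "mmul m (Rn t) (adj (Rn t))"]]
      show ?thesis by (simp add: dens_def mult.commute del: of_real_mult of_real_diff)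
    qed
    have sq: "(cmod (\<psi> x))\<^sup>2 * ?d x = (\<Sum>k\<in>UNIV. \<Sum>j\<in>UNIV. Re (cnj (z k) * z j) * ?e k j x)" for x
    proof -
      have Re_of_real: "Re (w * complex_of_real r) = Re w * r" for w r by simp
      have "(cmod (\<psi> x))\<^sup>2 = Re (cnj (\<psi> x) * \<psi> x)"
        by (metis Re_complex_of_real complex_norm_square mult.commute)
      also have "\<dots> = Re (\<Sum>k\<in>UNIV. \<Sum>j\<in>UNIV. (cnj (z k) * z j) * of_real ((x $ k - t $ k) * (x $ j - t $ j)))"
        unfolding \<psi>_def cnj_sum sum_product
        by (intro arg_cong[of _ _ Re] sum.cong refl) (simp add: \<phi>_def)
      also have "\<dots> = (\<Sum>k\<in>UNIV. \<Sum>j\<in>UNIV. Re (cnj (z k) * z j) * ((x $ k - t $ k) * (x $ j - t $ j)))"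
        unfolding Re_sum Re_of_real ..
      finally show ?thesis by (simp add: sum_distrib_right sum_distrib_left mult_ac)
    qed
    have m: "mse m M (tpow N n (\<rho> t)) t $ k $ j = (LINT x|\<mu>. ?e k j x)" for k j
      unfolding mse_def dn[OF t, symmetric]
      using integral_outcome(1)[OF nn[OF t], of "\<lambda>x. (x $ k - t $ k) * (x $ j - t $ j)"] by simp
    have i: "integrable \<mu> (\<lambda>x. (cmod (\<psi> x))\<^sup>2 * ?d x)"
      unfolding sq by (intro Bochner_Integration.integrable_sum integrable_mult_right ie)
    have "(LINT x|\<mu>. (cmod (\<psi> x))\<^sup>2 * ?d x) =
        (\<Sum>k\<in>UNIV. LINT x|\<mu>. (\<Sum>j\<in>UNIV. Re (cnj (z k) * z j) * ?e k j x))"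
      unfolding sq by (intro Bochner_Integration.integral_sum Bochner_Integration.integrable_sum integrable_mult_right ie)
    also have "\<dots> = (\<Sum>k\<in>UNIV. \<Sum>j\<in>UNIV. LINT x|\<mu>. Re (cnj (z k) * z j) * ?e k j x)"
      by (intro sum.cong refl Bochner_Integration.integral_sum integrable_mult_right ie)
    also have "\<dots> = (\<Sum>k\<in>UNIV. \<Sum>j\<in>UNIV. Re (cnj (z k) * z j) * mse m M (tpow N n (\<rho> t)) t $ k $ j)"
      unfolding m by (intro sum.cong refl integral_mult_right_zero)
    also have "\<dots> = Re (\<Sum>k\<in>UNIV. \<Sum>j\<in>UNIV. cnj (z k) * z j * V k j)"
      by (simp add: V_def)
    finally have int: "(LINT x|\<mu>. (cmod (\<psi> x))\<^sup>2 * ?d x) = Re (\<Sum>k\<in>UNIV. \<Sum>j\<in>UNIV. cnj (z k) * z j * V k j)" .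
    have "meq m (moment \<psi>) (\<lambda>a b. \<Sum>j\<in>UNIV. z j * X j a b)"
      unfolding X_def \<psi>_def[abs_def] by (rule moment_sum) (rule i\<phi>)
    then have "mtr m (mmul m (adj P) (mmul m (moment \<psi>) (Rn t)))
       = mtr m (mmul m (adj P) (mmul m (\<lambda>a b. \<Sum>j\<in>UNIV. z j * X j a b) (Rn t)))"
      by (intro mtr_cong mmul_cong meq_refl)
    also have "\<dots> = (\<Sum>j\<in>UNIV. z j * mtr m (mmul m (adj P) (mmul m (X j) (Rn t))))"
      by (simp add: mmul_sum_left mmul_sum_right mtr_sum)
    finally have cross: "mtr m (mmul m (adj P) (mmul m (moment \<psi>) (Rn t))) = \<dots>" .
    show ?thesis
      using test_operator_inequality[OF i\<psi> i, of P] unfolding int cross unfolding Rn_def .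
  qed

  have tr1: "mtr N (mmul N (R t) (adj (R t))) = 1"
    using mtr_cong[OF R[OF t]] tr\<rho>[OF t] by simp
  obtain Y where Y: "\<And>j. adj (Y j) = Y j"
    and YK: "\<And>K j. mtr N K = 0 \<Longrightarrow>
      mtr N (mmul N K (Y j)) = mtr m (mmul m (tder N (mmul N (R t) (adj (R t))) n K) (X j))"
    and YV: "\<And>z. Re (\<Sum>k\<in>UNIV. \<Sum>j\<in>UNIV. cnj (z k) * z j * mtr N (mmul N (mmul N (R t) (adj (R t))) (mmul N (Y k) (Y j))))
       \<le> real n * Re (\<Sum>k\<in>UNIV. \<Sum>j\<in>UNIV. cnj (z k) * z j * V k j)"
    using that by (rule single_copy_reduction[OF N n tr1 Xh, unfolded m_def[symmetric], OF le])

  define D where "D v = (\<lambda>i j. frechet_derivative (\<lambda>s. \<rho> s i j) (at t) v)" for v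
  have D: "((\<lambda>s. \<rho> s i j) has_derivative (\<lambda>v. D v i j)) (at t)" if "i < N" "j < N" for i j
  proof -
    have "cont_diff_on (Suc 0) \<Theta> (\<lambda>s. \<rho> s i j)"
      using sm[OF that, unfolded smooth_on_def] by (rule spec)
    then have "(\<lambda>s. \<rho> s i j) differentiable_on \<Theta>"
      unfolding cont_diff_on.simps by (rule conjunct1)
    then have "(\<lambda>s. \<rho> s i j) differentiable (at t)"
      using t by (simp only: differentiable_on_eq_differentiable_at[OF op])
    then show ?thesis unfolding D_def by (simp add: frechet_derivative_works)
  qed
  \<comment> \<open>The trace is constant on \<Theta>, so the derivatives of the state are
    traceless; on such directions \<open>Y\<close> represents the functional.\<close>
  have trD: "mtr N (D v) = 0" for v
  proof -
    have 1: "((\<lambda>s. mtr N (\<rho> s)) has_derivative (\<lambda>v. mtr N (D v))) (at t)"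
      unfolding mtr_def by (intro has_derivative_sum D) auto
    have "((\<lambda>s. 1::complex) has_derivative (\<lambda>v. mtr N (D v))) (at t)"
      by (rule has_derivative_transform_within_open[OF 1 op t]) (simp add: tr\<rho>)
    from has_derivative_unique[OF this has_derivative_const] show ?thesis by metis
  qed
  define F where "F j s = mtr m (mmul m (X j) (tpow N n (\<rho> s)))" for j s
  define F' where "F' j v = mtr m (mmul m (X j) (tder N (\<rho> t) n (D v)))" for j v
  have F': "(F j has_derivative F' j) (at t)" for j
    unfolding F_def[abs_def] F'_def[abs_def] mtr_def mmul_def m_def
    by (intro has_derivative_sum has_derivative_mult_right has_derivative_tpow[OF N D]) auto
  have ImF: "Im (F j s) = 0" if "s \<in> \<Theta>" for j s
  proof -
    have e: "F j s = mtr m (mmul m (X j) (mmul m (Rn s) (adj (Rn s))))"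
      unfolding F_def by (intro mtr_cong mmul_cong meq_refl tp that)
    have "cnj (F j s) = F j s"
      unfolding e mtr_adj[symmetric] adj_mmul adj_adj Xh by (rule mtr_mmul_comm)
    then show ?thesis by (metis cnj.sel(2) neg_equal_zero)
  qed
  \<comment> \<open>The complex function \<open>F j\<close> is real on the open set \<Theta>, hence
    so is its derivative. This identifies the complex trace in \<open>Yd\<close> with a real partial
    derivative.\<close>
  have ImF': "Im (F' j v) = 0" for j v
  proof -
    have "((\<lambda>s. Im (F j s)) has_derivative (\<lambda>v. Im (F' j v))) (at t)"
      by (rule bounded_linear.has_derivative[OF bounded_linear_Im F'])
    then have "((\<lambda>s. 0::real) has_derivative (\<lambda>v. Im (F' j v))) (at t)"
      by (rule has_derivative_transform_within_open[OF _ op t]) (simp add: ImF)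
    from has_derivative_unique[OF this has_derivative_const] show ?thesis by metis
  qed
  have pd: "pderiv_at k (\<lambda>s. expect m M (tpow N n (\<rho> s)) $ j) t = Re (F' j (axis k 1))" for k j
  proof -
    have "((\<lambda>s. t $ j + Re (F j s)) has_derivative (\<lambda>v. 0 + Re (F' j v))) (at t)"
      by (intro has_derivative_add has_derivative_const bounded_linear.has_derivative[OF bounded_linear_Re F'])
    then have "((\<lambda>s. expect m M (tpow N n (\<rho> s)) $ j) has_derivative (\<lambda>v. 0 + Re (F' j v))) (at t)"
      by (rule has_derivative_transform_within_open[OF _ op t]) (simp add: ex F_def)
    from frechet_derivative_at[OF this] show ?thesis
      unfolding pderiv_at_def by (metis add_0)
  qed
  have Yd: "mtr N (mmul N (drho \<rho> t k) (Y j)) = of_real (pderiv_at k (\<lambda>s. expect m M (tpow N n (\<rho> s)) $ j) t)" for k j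
  proof -
    have dD: "drho \<rho> t k = D (axis k 1)" by (simp add: drho_def D_def pderiv_at_def)
    have "mtr N (mmul N (D (axis k 1)) (Y j)) = mtr m (mmul m (tder N (mmul N (R t) (adj (R t))) n (D (axis k 1))) (X j))"
      by (rule YK[OF trD])
    also have "\<dots> = mtr m (mmul m (tder N (\<rho> t) n (D (axis k 1))) (X j))"
      unfolding m_def by (intro mtr_cong mmul_cong tder_cong meq_sym[OF R[OF t]] meq_refl)
    also have "\<dots> = F' j (axis k 1)" unfolding F'_def by (rule mtr_mmul_comm)
    also have "\<dots> = of_real (Re (F' j (axis k 1)))" using ImF'[of j "axis k 1"] by (simp add: complex_eq_iff)
    finally show ?thesis unfolding dD pd .
  qed
  have eq: "mtr N (mmul N (mmul N (R t) (adj (R t))) K) = mtr N (mmul N (\<rho> t) K)" for K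
    by (intro mtr_cong mmul_cong meq_sym[OF R[OF t]] meq_refl)
  show thesis
    by (rule that[OF Y Yd[unfolded m_def] YV[unfolded eq V_def m_def]])
qed

subsection \<open>The Holevo bound\<close>

lemma Zmat_hermitian:
  assumes \<sigma>: "hermitian N \<sigma>" and X: "\<And>k. hermitian N (X k)"
  shows "Zmat N \<sigma> X $ j $ k = cnj (Zmat N \<sigma> X $ k $ j)"
proof -
  have m: "meq N (adj A) A" if "hermitian N A" for A
    using that unfolding meq_def hermitian_def adj_def by (metis complex_cnj_cnj)
  have "cnj (Zmat N \<sigma> X $ k $ j) = mtr N (mmul N (mmul N (adj (X j)) (adj (X k))) (adj \<sigma>))"
    by (simp add: Zmat_def mtr_adj[symmetric] adj_mmul)
  also have "\<dots> = mtr N (mmul N (mmul N (X j) (X k)) \<sigma>)"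
    by (intro mtr_cong mmul_cong m \<sigma> X)
  finally show ?thesis by (simp add: Zmat_def mtr_mmul_comm[of N \<sigma>])
qed

lemma ImM_Zmat_antisymmetric:
  assumes "hermitian N \<sigma>" "\<And>k. hermitian N (X k)"
  shows "transpose (ImM (Zmat N \<sigma> X)) = - ImM (Zmat N \<sigma> X)"
proof -
  have *: "Im (Zmat N \<sigma> X $ j $ i) = - Im (Zmat N \<sigma> X $ i $ j)" for i j
    unfolding Zmat_hermitian[OF assms, where j = j and k = i] by (rule cnj.sel(2))
  show ?thesis by (simp add: transpose_def ImM_def vec_eq_iff) (intro allI *)
qed

lemma pos_def_imp_psd: "pos_def m A \<Longrightarrow> psd m A"
  unfolding pos_def_def psd_def
proof (intro conjI allI)
  fix v
  assume A: "hermitian m A \<and> (\<forall>v. (\<exists>i<m. v i \<noteq> 0) \<longrightarrow> 0 < Re (qform m A v))"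
  show "0 \<le> Re (qform m A v)"
  proof (cases "\<exists>i<m. v i \<noteq> 0")
    case True then show ?thesis using A by (metis less_imp_le)
  next
    case False then show ?thesis by (simp add: qform_def)
  qed
qed auto

lemma inner_mult_eq_sum:
  fixes A :: "real^'d^'d"
  shows "a \<bullet> (A *v b) = (\<Sum>k\<in>UNIV. \<Sum>j\<in>UNIV. a $ k * b $ j * A $ k $ j)"
  by (simp add: inner_vec_def matrix_vector_mult_def sum_distrib_left mult_ac)

text \<open>For real \<open>a\<close> the form is the expectation of the square of the Hermitian
  combination \<open>B\<close> of the \<open>X k\<close> with coefficients \<open>a\<close>.\<close>

lemma ReM_Zmat_nonneg:
  assumes \<sigma>: "psd N \<sigma>" and X: "\<And>k. hermitian N (X k)"
  shows "0 \<le> a \<bullet> (ReM (Zmat N \<sigma> X) *v a)"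
proof -
  define B where "B = (\<lambda>i l. \<Sum>k\<in>UNIV. complex_of_real (a $ k) * X k i l)"
  have "a \<bullet> (ReM (Zmat N \<sigma> X) *v a) = Re (mtr N (mmul N \<sigma> (mmul N B B)))"
    unfolding inner_mult_eq_sum B_def mmul_sum_left mmul_sum_right mtr_sum
    by (simp add: ReM_def Zmat_def sum_distrib_left mult_ac)
  also have "mtr N (mmul N \<sigma> (mmul N B B)) = mtr N (mmul N B (mmul N \<sigma> B))"
    by (simp add: mtr_mmul_rotate[of N B])
  also have "\<dots> = mtr N (mmul N (adj B) (mmul N \<sigma> B))"
  proof (intro mtr_cong mmul_cong meq_refl)
    have "cnj (X k l i) = X k i l" if "i < N" "l < N" for k i l
      using X[of k] that unfolding hermitian_def by (metis complex_cnj_cnj)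
    then show "meq N B (adj B)" by (simp add: meq_def adj_def B_def)
  qed
  finally show ?thesis using psd_conjugate_trace_nonneg[OF \<sigma>, of B] by simp
qed

lemma trace_congruence_nonneg:
  fixes S A :: "real^'d^'d"
  assumes "transpose S = S" "\<And>a. 0 \<le> a \<bullet> (A *v a)"
  shows "0 \<le> trace (S ** A ** S)"
proof -
  have "(S ** A ** S) $ i $ i = (S *v axis i 1) \<bullet> (A *v (S *v axis i 1))" for i
  proof -
    have "(S ** A ** S) $ i $ i = axis i 1 \<bullet> ((S ** A ** S) *v axis i 1)"
      by (simp add: inner_axis' matrix_vector_mult_basis column_def)
    also have "\<dots> = axis i 1 \<bullet> (S *v (A *v (S *v axis i 1)))"
      by (simp only: matrix_vector_mul_assoc matrix_mul_assoc)
    also have "\<dots> = (S *v axis i 1) \<bullet> (A *v (S *v axis i 1))"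
      using inner_matrix_transpose[of "axis i 1" S] assms(1) by simp
    finally show ?thesis .
  qed
  then show ?thesis unfolding trace_def by (simp add: sum_nonneg assms(2))
qed

lemma weight_matrix_imp_psd: "weight_matrix G \<Longrightarrow> psd_real G"
  unfolding weight_matrix_def psd_real_def by (metis inner_zero_left less_imp_le order_refl)

text \<open>Provides the lower bound that a real \<open>Inf\<close> needs before it can be compared
  with its members, as in \<open>holevo_bound_le\<close>.\<close>

lemma CGX_nonneg:
  assumes "weight_matrix G" "psd N \<sigma>" "\<And>k. hermitian N (X k)"
  shows "0 \<le> CGX N \<sigma> G X"
  unfolding CGX_def
  using psd_real_msqrt[OF weight_matrix_imp_psd[OF assms(1)]]
  by (intro add_nonneg_nonneg trace_congruence_nonneg trace_abs_nonneg ReM_Zmat_nonneg assms)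
    (simp add: psd_real_def)

text \<open>A real change of operators by \<open>C\<close> turns \<open>Z\<close> into
  \<open>C Z C^T\<close>, so the complex matrix inequality survives congruence by
  \<open>T = S C\<close>. Then \<open>trace_abs_le_trace\<close>, applied to the transformed
  \<open>V - Re Z\<close> and \<open>Im Z\<close>, bounds both summands of the Holevo functional
  together.\<close>

lemma CGX_linear_change_le:
  fixes G C V :: "real^'d::finite^'d" and Y :: "'d \<Rightarrow> cmat"
  assumes G: "weight_matrix G" and \<sigma>: "hermitian N \<sigma>" and Y: "\<And>k. adj (Y k) = Y k"
    and le: "\<And>z. Re (\<Sum>k\<in>UNIV. \<Sum>j\<in>UNIV. cnj (z k) * z j * Zmat N \<sigma> Y $ k $ j)
      \<le> Re (\<Sum>k\<in>UNIV. \<Sum>j\<in>UNIV. cnj (z k) * z j * complex_of_real (V $ k $ j))"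
  shows "CGX N \<sigma> G (\<lambda>j a b. \<Sum>l\<in>UNIV. complex_of_real (C $ j $ l) * Y l a b)
    \<le> trace ((msqrt G ** C) ** V ** transpose (msqrt G ** C))"
proof -
  define S where "S = msqrt G"
  define T where "T = S ** C"
  define R where "R = ReM (Zmat N \<sigma> Y)"
  define I where "I = ImM (Zmat N \<sigma> Y)"
  define Y' where "Y' j = (\<lambda>a b. \<Sum>l\<in>UNIV. complex_of_real (C $ j $ l) * Y l a b)" for j
  have ST: "transpose S = S"
    using psd_real_msqrt[OF weight_matrix_imp_psd[OF G]] by (simp add: S_def psd_real_def)
  have Yh: "hermitian N (Y k)" for k by (rule hermitian_if_adj_eq[OF Y])
  have anti: "transpose I = - I" unfolding I_def by (rule ImM_Zmat_antisymmetric[OF \<sigma> Yh])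
  have Z': "Zmat N \<sigma> Y' $ k $ j
      = (\<Sum>l\<in>UNIV. \<Sum>p\<in>UNIV. complex_of_real (C $ k $ l * C $ j $ p) * Zmat N \<sigma> Y $ l $ p)" for k j
  proof -
    have "Zmat N \<sigma> Y' $ k $ j = mtr N (mmul N \<sigma> (mmul N (Y' k) (Y' j)))" by (simp add: Zmat_def)
    also have "\<dots> = (\<Sum>l\<in>UNIV. complex_of_real (C $ k $ l) *
        (\<Sum>p\<in>UNIV. complex_of_real (C $ j $ p) * mtr N (mmul N \<sigma> (mmul N (Y l) (Y p)))))"
      unfolding Y'_def mmul_sum_left unfolding mmul_sum_right mtr_sum ..
    finally show ?thesis by (simp add: Zmat_def sum_distrib_left mult.assoc)
  qed
  have R': "ReM (Zmat N \<sigma> Y') = C ** R ** transpose C"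
  proof (simp only: vec_eq_iff, intro allI)
    fix k j
    have "(C ** R ** transpose C) $ k $ j = (\<Sum>p\<in>UNIV. \<Sum>l\<in>UNIV. C $ k $ l * C $ j $ p * R $ l $ p)"
      by (simp add: matrix_matrix_mult_def transpose_def sum_distrib_left sum_distrib_right mult_ac)
    also have "\<dots> = (\<Sum>l\<in>UNIV. \<Sum>p\<in>UNIV. C $ k $ l * C $ j $ p * R $ l $ p)" by (rule sum.swap)
    finally show "ReM (Zmat N \<sigma> Y') $ k $ j = (C ** R ** transpose C) $ k $ j"
      by (simp add: ReM_def R_def Z')
  qed
  have I': "ImM (Zmat N \<sigma> Y') = C ** I ** transpose C"
  proof (simp only: vec_eq_iff, intro allI)
    fix k j
    have "(C ** I ** transpose C) $ k $ j = (\<Sum>p\<in>UNIV. \<Sum>l\<in>UNIV. C $ k $ l * C $ j $ p * I $ l $ p)"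
      by (simp add: matrix_matrix_mult_def transpose_def sum_distrib_left sum_distrib_right mult_ac)
    also have "\<dots> = (\<Sum>l\<in>UNIV. \<Sum>p\<in>UNIV. C $ k $ l * C $ j $ p * I $ l $ p)" by (rule sum.swap)
    finally show "ImM (Zmat N \<sigma> Y') $ k $ j = (C ** I ** transpose C) $ k $ j"
      by (simp add: ImM_def I_def Z')
  qed
  \<comment> \<open>The hypothesis at \<open>z = a + i b\<close>. The real matrix \<open>V\<close>
    gives no mixed term, and by antisymmetry the two mixed terms of \<open>I\<close>
    coincide.\<close>
  have quad: "2 * (b \<bullet> (I *v a)) \<le> (a \<bullet> (V *v a) - a \<bullet> (R *v a)) + (b \<bullet> (V *v b) - b \<bullet> (R *v b))" for a b
  proof -
    define z where "z k = Complex (a $ k) (b $ k)" for k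
    have nI: "(- I) *v b = - (I *v b)" by (simp add: vec_eq_iff matrix_vector_mult_def sum_negf)
    have "a \<bullet> (I *v b) = - ((I *v a) \<bullet> b)"
    proof -
      have "(- I) *v a = - (I *v a)" by (simp add: vec_eq_iff matrix_vector_mult_def sum_negf)
      then show ?thesis using inner_matrix_transpose[of a I b] anti by simp
    qed
    then have ab: "a \<bullet> (I *v b) = - (b \<bullet> (I *v a))" by (simp add: inner_commute)
    have zz: "Re (cnj (z k) * z j * w) = a $ k * a $ j * Re w + b $ k * b $ j * Re w
        + (b $ k * a $ j * Im w - a $ k * b $ j * Im w)" for k j w
      by (simp add: z_def algebra_simps)
    have "Re (\<Sum>k\<in>UNIV. \<Sum>j\<in>UNIV. cnj (z k) * z j * Zmat N \<sigma> Y $ k $ j)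
        = a \<bullet> (R *v a) + b \<bullet> (R *v b) + (b \<bullet> (I *v a) - a \<bullet> (I *v b))"
      unfolding Re_sum zz inner_mult_eq_sum
      by (simp add: sum.distrib sum_subtractf R_def I_def ReM_def ImM_def)
    moreover have "Re (\<Sum>k\<in>UNIV. \<Sum>j\<in>UNIV. cnj (z k) * z j * complex_of_real (V $ k $ j))
        = a \<bullet> (V *v a) + b \<bullet> (V *v b)"
      unfolding Re_sum zz inner_mult_eq_sum by (simp add: sum.distrib)
    ultimately show ?thesis using le[of z] ab by simp
  qed
  have inner_T: "b \<bullet> ((T ** A ** transpose T) *v a) = (transpose T *v b) \<bullet> (A *v (transpose T *v a))" for a b A
    unfolding matrix_vector_mul_assoc[symmetric] by (rule inner_matrix_transpose)
  have conj: "S ** (C ** A ** transpose C) ** S = T ** A ** transpose T" for A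
    by (simp add: T_def matrix_transpose_mul ST matrix_mul_assoc)
  have neg: "T ** (- I) ** transpose T = - (T ** I ** transpose T)"
    by (simp add: matrix_matrix_mult_def vec_eq_iff sum_negf)
  have "trace_abs (T ** I ** transpose T) \<le> trace (T ** V ** transpose T - T ** R ** transpose T)"
  proof (rule trace_abs_le_trace)
    show "transpose (T ** I ** transpose T) = - (T ** I ** transpose T)"
      using neg by (simp add: matrix_transpose_mul anti matrix_mul_assoc)
    show "2 * (b \<bullet> ((T ** I ** transpose T) *v a))
      \<le> a \<bullet> ((T ** V ** transpose T - T ** R ** transpose T) *v a)
        + b \<bullet> ((T ** V ** transpose T - T ** R ** transpose T) *v b)" for a b
      using quad[of "transpose T *v b" "transpose T *v a"]
      by (simp add: matrix_vector_mult_diff_rdistrib inner_diff_right inner_T)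
  qed
  then have "CGX N \<sigma> G Y' \<le> trace (T ** V ** transpose T)"
    by (simp add: CGX_def S_def[symmetric] R' I' conj trace_sub)
  then show ?thesis by (simp add: Y'_def[abs_def] T_def S_def)
qed

lemma holevo_bound_le:
  assumes G: "weight_matrix G" and \<sigma>: "psd N (\<rho> t)"
    and X: "\<And>k. hermitian N (X k)"
    and unb: "\<And>k j. mtr N (mmul N (drho \<rho> t k) (X j)) = (if j = k then 1 else 0)"
  shows "holevo_bound N \<rho> t G \<le> CGX N (\<rho> t) G X"
  unfolding holevo_bound_def
proof (rule cInf_lower)
  show "bdd_below {CGX N (\<rho> t) G X |X. (\<forall>k. hermitian N (X k)) \<and>
      (\<forall>k j. mtr N (mmul N (drho \<rho> t k) (X j)) = (if j = k then 1 else 0))}"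
    by (rule bdd_belowI[of _ 0]) (use CGX_nonneg[OF G \<sigma>] in auto)
qed (use X unb in blast)

section \<open>Passage to a derivative matrix tending to the identity\<close>

lemma abs_entry_le_trace:
  fixes U :: "real^'d^'d"
  assumes U: "psd_real U"
  shows "\<bar>U $ i $ j\<bar> \<le> trace U"
proof -
  have sym: "U $ j $ i = U $ i $ j"
    using U unfolding psd_real_def transpose_def by (metis vec_lambda_beta)
  have q: "0 \<le> U $ i $ i + 2 * s * U $ i $ j + s^2 * U $ j $ j" for s
  proof -
    have col: "U *v axis k 1 = column k U" for k by (rule matrix_vector_mult_basis)
    have "0 \<le> (axis i 1 + s *\<^sub>R axis j 1) \<bullet> (U *v (axis i 1 + s *\<^sub>R axis j 1))"
      using U by (simp add: psd_real_def)
    also have "\<dots> = U $ i $ i + 2 * s * U $ i $ j + s^2 * U $ j $ j"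
      by (simp add: matrix_vector_right_distrib matrix_vector_mult_scaleR col inner_add_left inner_add_right
          inner_axis' column_def sym power2_eq_square algebra_simps)
    finally show ?thesis .
  qed
  have d: "0 \<le> U $ k $ k" for k
  proof -
    have "0 \<le> axis k 1 \<bullet> (U *v axis k 1)" using U by (simp add: psd_real_def)
    then show ?thesis by (simp add: matrix_vector_mult_basis inner_axis' column_def)
  qed
  have le: "U $ k $ k \<le> trace U" for k
    unfolding trace_def by (rule member_le_sum) (use d in auto)
  have "2 * \<bar>U $ i $ j\<bar> \<le> U $ i $ i + U $ j $ j"
    using q[of 1] q[of "-1"] by auto
  then show ?thesis using le[of i] le[of j] by linarith
qed

text \<open>With \<open>transpose T ** T = 1 + K\<close> the right side is
  \<open>tr U + tr (K U)\<close>, and each entry of the positive matrix \<open>U\<close> is at most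
  \<open>tr U\<close> in absolute value.\<close>

lemma trace_congruence_ge:
  fixes T U :: "real^'d^'d"
  assumes U: "psd_real U"
  shows "(1 - (\<Sum>i\<in>UNIV. \<Sum>j\<in>UNIV. \<bar>(transpose T ** T - mat 1) $ i $ j\<bar>)) * trace U \<le> trace (T ** U ** transpose T)"
proof -
  define K where "K = transpose T ** T - mat 1"
  have "trace (T ** U ** transpose T) = trace (transpose T ** T ** U)"
    using trace_mul_sym[of "T ** U" "transpose T"] by (simp add: matrix_mul_assoc)
  also have "transpose T ** T ** U = K ** U + U"
  proof -
    have "K ** U = transpose T ** T ** U - U"
    proof -
      have "(A - B) ** U = A ** U - B ** U" for A B :: "real^'d^'d"
        by (simp add: matrix_matrix_mult_def vec_eq_iff left_diff_distrib sum_subtractf)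
      then show ?thesis by (simp add: K_def)
    qed
    then show ?thesis by simp
  qed
  also have "trace \<dots> = trace (K ** U) + trace U" by (rule trace_add)
  finally have eq: "trace (T ** U ** transpose T) = trace (K ** U) + trace U" .
  have "\<bar>trace (K ** U)\<bar> \<le> (\<Sum>i\<in>UNIV. \<Sum>j\<in>UNIV. \<bar>K $ i $ j * U $ j $ i\<bar>)"
    unfolding trace_def matrix_matrix_mult_def
    by (simp, rule order_trans[OF sum_abs], rule sum_mono, rule sum_abs)
  also have "\<dots> \<le> (\<Sum>i\<in>UNIV. \<Sum>j\<in>UNIV. \<bar>K $ i $ j\<bar> * trace U)"
    by (intro sum_mono) (simp add: abs_mult mult_left_mono abs_entry_le_trace[OF U])
  finally have "- ((\<Sum>i\<in>UNIV. \<Sum>j\<in>UNIV. \<bar>K $ i $ j\<bar>) * trace U) \<le> trace (K ** U)"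
    by (simp add: sum_distrib_right abs_le_iff)
  then show ?thesis unfolding eq K_def[symmetric] by (simp add: algebra_simps)
qed

text \<open>Transforming the single-copy operators by the inverse of the derivative matrix \<open>A_n\<close> makes them satisfy
  the constraint of the Holevo bound; the congruence by \<open>T\<close> takes the transformed mean square error
  back to the original one, so no estimate on the inverse is needed.\<close>
lemma holevo_bound_le_scaled_mse:
  fixes \<rho> :: "real^'d::finite \<Rightarrow> cmat" and G :: "real^'d^'d" and Ms :: "nat \<Rightarrow> (real^'d) set \<Rightarrow> cmat"
  assumes model: "qmodel N \<Theta> \<rho>" and t: "t \<in> \<Theta>" and G: "weight_matrix G"
    and est: "estimator_seq N \<Theta> \<rho> Ms" and n: "0 < n"
    and inv: "invertible (A_n N \<rho> Ms n t)" and S': "msqrt G ** S' = mat 1" "S' ** msqrt G = mat 1"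
    and T: "T = msqrt G ** A_n N \<rho> Ms n t ** S'"
    and small: "(\<Sum>i\<in>UNIV. \<Sum>j\<in>UNIV. \<bar>(transpose T ** T - mat 1) $ i $ j\<bar>) \<le> 1"
  shows "(1 - (\<Sum>i\<in>UNIV. \<Sum>j\<in>UNIV. \<bar>(transpose T ** T - mat 1) $ i $ j\<bar>)) * holevo_bound N \<rho> t G
    \<le> real n * trace (G ** V_n N \<rho> Ms n t)"
proof -
  define S where "S = msqrt G"
  define A where "A = A_n N \<rho> Ms n t"
  define V where "V = real n *\<^sub>R V_n N \<rho> Ms n t"
  obtain C where C: "A ** C = mat 1" "C ** A = mat 1"
    using inv unfolding invertible_def A_def by blast
  have S: "psd_real S" "S ** S = G"
    unfolding S_def by (rule psd_real_msqrt[OF weight_matrix_imp_psd[OF G]]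
        msqrt_mult_self[OF weight_matrix_imp_psd[OF G]])+
  have ST: "transpose S = S" using S by (simp add: psd_real_def)
  have pd: "pos_def N (\<rho> t)" using model t by (auto simp: qmodel_def strict_density_def)
  have \<sigma>: "psd N (\<rho> t)" by (rule pos_def_imp_psd[OF pd])
  have \<sigma>h: "hermitian N (\<rho> t)" using pd by (simp add: pos_def_def)
  have povm: "is_povm (N ^ n) (Ms n)"
    and L2: "integrable (outcome (N ^ n) (Ms n) (tpow N n (\<rho> t))) (\<lambda>x. (x $ j)\<^sup>2)" for j
    using est t by (auto simp: estimator_seq_def)
  obtain Y where Y: "\<And>j. adj (Y j) = Y j"
    and Yd: "\<And>k j. mtr N (mmul N (drho \<rho> t k) (Y j))
      = of_real (pderiv_at k (\<lambda>s. expect (N^n) (Ms n) (tpow N n (\<rho> s)) $ j) t)"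
    and YV: "\<And>z. Re (\<Sum>k\<in>UNIV. \<Sum>j\<in>UNIV. cnj (z k) * z j * mtr N (mmul N (\<rho> t) (mmul N (Y k) (Y j))))
      \<le> real n * Re (\<Sum>k\<in>UNIV. \<Sum>j\<in>UNIV. cnj (z k) * z j *
          of_real (mse (N^n) (Ms n) (tpow N n (\<rho> t)) t $ k $ j))"
    using that by (rule single_copy_operators[OF model t n povm L2])
  have le: "Re (\<Sum>k\<in>UNIV. \<Sum>j\<in>UNIV. cnj (z k) * z j * Zmat N (\<rho> t) Y $ k $ j)
      \<le> Re (\<Sum>k\<in>UNIV. \<Sum>j\<in>UNIV. cnj (z k) * z j * complex_of_real (V $ k $ j))" for z
  proof -
    have "(\<Sum>k\<in>UNIV. \<Sum>j\<in>UNIV. cnj (z k) * z j * complex_of_real (V $ k $ j))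
      = complex_of_real (real n) * (\<Sum>k\<in>UNIV. \<Sum>j\<in>UNIV. cnj (z k) * z j *
          of_real (mse (N^n) (Ms n) (tpow N n (\<rho> t)) t $ k $ j))"
      by (simp add: V_def V_n_def sum_distrib_left mult_ac)
    then show ?thesis using YV[of z] by (simp add: Zmat_def del: Re_sum)
  qed
  have Yh: "hermitian N (Y k)" for k by (rule hermitian_if_adj_eq[OF Y])

  \<comment> \<open>Inherited from the real part of \<open>Z(Y)\<close> by testing \<open>le\<close>
    at real vectors.\<close>
  have Vpsd: "psd_real V"
    unfolding psd_real_def
  proof (intro conjI allI)
    show "transpose V = V"
      by (simp add: V_def V_n_def mse_def transpose_def vec_eq_iff mult.commute)
    fix a
    have "a \<bullet> (ReM (Zmat N (\<rho> t) Y) *v a)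
        = Re (\<Sum>k\<in>UNIV. \<Sum>j\<in>UNIV. cnj (complex_of_real (a $ k)) * complex_of_real (a $ j) * Zmat N (\<rho> t) Y $ k $ j)"
      by (simp add: inner_mult_eq_sum ReM_def)
    also have "\<dots> \<le> Re (\<Sum>k\<in>UNIV. \<Sum>j\<in>UNIV. cnj (complex_of_real (a $ k)) * complex_of_real (a $ j) *
        complex_of_real (V $ k $ j))"
      by (rule le)
    also have "\<dots> = a \<bullet> (V *v a)" by (simp add: inner_mult_eq_sum)
    finally show "0 \<le> a \<bullet> (V *v a)" using ReM_Zmat_nonneg[where X = Y, OF \<sigma> Yh, of a] by linarith
  qed

  define Y' where "Y' j = (\<lambda>a b. \<Sum>l\<in>UNIV. complex_of_real (C $ j $ l) * Y l a b)" for j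
  have Y'h: "hermitian N (Y' j)" for j
  proof (rule hermitian_if_adj_eq)
    show "adj (Y' j) = Y' j" unfolding Y'_def adj_sum Y by simp
  qed
  have unb: "mtr N (mmul N (drho \<rho> t k) (Y' j)) = (if j = k then 1 else 0)" for k j
  proof -
    have "mtr N (mmul N (drho \<rho> t k) (Y' j)) = complex_of_real (\<Sum>l\<in>UNIV. C $ j $ l * A $ l $ k)"
      unfolding Y'_def mmul_sum_right mtr_sum Yd by (simp add: A_def A_n_def E_n_def)
    also have "(\<Sum>l\<in>UNIV. C $ j $ l * A $ l $ k) = (C ** A) $ j $ k" by (simp add: matrix_matrix_mult_def)
    also have "\<dots> = (if j = k then 1 else 0)" unfolding C by (simp add: mat_def)
    finally show ?thesis by simp
  qed
  define U where "U = (S ** C) ** V ** transpose (S ** C)"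
  have H: "holevo_bound N \<rho> t G \<le> trace U"
  proof -
    have "holevo_bound N \<rho> t G \<le> CGX N (\<rho> t) G Y'" by (rule holevo_bound_le[where X = Y', OF G \<sigma> Y'h unb])
    also have "\<dots> \<le> trace U"
      using CGX_linear_change_le[where Y = Y, OF G \<sigma>h Y le, of C] by (simp add: Y'_def[abs_def] U_def S_def)
    finally show ?thesis .
  qed
  have Upsd: "psd_real U"
    unfolding psd_real_def
  proof (intro conjI allI)
    have VT: "transpose V = V" using Vpsd by (simp add: psd_real_def)
    show "transpose U = U" by (simp add: U_def matrix_transpose_mul VT matrix_mul_assoc)
    fix x
    have "x \<bullet> (U *v x) = (transpose (S ** C) *v x) \<bullet> (V *v (transpose (S ** C) *v x))"
      unfolding U_def matrix_vector_mul_assoc[symmetric, of "S ** C ** V"]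
        matrix_vector_mul_assoc[symmetric, of "S ** C" V]
      by (rule inner_matrix_transpose)
    then show "0 \<le> x \<bullet> (U *v x)" using Vpsd by (simp add: psd_real_def)
  qed
  have TSC: "T ** (S ** C) = S"
  proof -
    have "T ** (S ** C) = S ** A ** (S' ** S) ** C" by (simp add: T S_def A_def matrix_mul_assoc)
    also have "\<dots> = S ** (A ** C)" using S'(2) by (simp add: S_def matrix_mul_assoc)
    finally show ?thesis using C(1) by simp
  qed
  have "T ** U ** transpose T = (T ** (S ** C)) ** V ** transpose (T ** (S ** C))"
    by (simp add: U_def matrix_transpose_mul matrix_mul_assoc)
  then have "trace (T ** U ** transpose T) = trace (S ** V ** S)" unfolding TSC ST by simp
  also have "\<dots> = trace (G ** V)"
    using trace_mul_sym[of "S ** V" S] S(2) by (simp add: matrix_mul_assoc)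
  also have "\<dots> = real n * trace (G ** V_n N \<rho> Ms n t)"
    by (simp add: V_def trace_def matrix_matrix_mult_def sum_distrib_left mult_ac)
  finally have tr: "trace (T ** U ** transpose T) = real n * trace (G ** V_n N \<rho> Ms n t)" .
  \<comment> \<open>\<open>small\<close> makes the factor nonnegative, so that it can multiply the
    inequality \<open>H\<close>.\<close>
  have "(1 - (\<Sum>i\<in>UNIV. \<Sum>j\<in>UNIV. \<bar>(transpose T ** T - mat 1) $ i $ j\<bar>)) * holevo_bound N \<rho> t G
    \<le> (1 - (\<Sum>i\<in>UNIV. \<Sum>j\<in>UNIV. \<bar>(transpose T ** T - mat 1) $ i $ j\<bar>)) * trace U"
    using small H by (intro mult_left_mono) simp_all
  also have "\<dots> \<le> real n * trace (G ** V_n N \<rho> Ms n t)"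
    using trace_congruence_ge[OF Upsd, of T] unfolding tr .
  finally show ?thesis .
qed

lemma msqrt_weight_matrix_invertible:
  assumes G: "weight_matrix G"
  shows "invertible (msqrt G)"
proof -
  have "x = 0" if "msqrt G *v x = 0" for x
  proof (rule ccontr)
    assume "x \<noteq> 0"
    then have "0 < x \<bullet> (G *v x)" using G by (simp add: weight_matrix_def)
    moreover have "G *v x = msqrt G *v (msqrt G *v x)"
      by (simp add: matrix_vector_mul_assoc msqrt_mult_self[OF weight_matrix_imp_psd[OF G]])
    ultimately show False using that by simp
  qed
  then have "\<exists>B. B ** msqrt G = mat 1" by (simp add: matrix_left_invertible_ker)
  then show ?thesis by (simp add: invertible_left_inverse)
qed

lemma holevo_bound_le_liminf:
  fixes \<rho> :: "real^'d::finite \<Rightarrow> cmat" and G :: "real^'d^'d" and Ms :: "nat \<Rightarrow> (real^'d) set \<Rightarrow> cmat"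
  assumes model: "qmodel N \<Theta> \<rho>" and t: "t \<in> \<Theta>" and G: "weight_matrix G"
    and est: "estimator_seq N \<Theta> \<rho> Ms" and unb: "asym_unbiased N \<rho> t Ms"
  shows "ereal (holevo_bound N \<rho> t G) \<le> liminf (\<lambda>n. ereal (real n * trace (G ** V_n N \<rho> Ms n t)))"
proof -
  define A where "A n = A_n N \<rho> Ms n t" for n
  have A: "A \<longlonglongrightarrow> mat 1" using unb by (simp add: asym_unbiased_def A_def[abs_def])
  obtain S' where S': "msqrt G ** S' = mat 1" "S' ** msqrt G = mat 1"
    using msqrt_weight_matrix_invertible[OF G] unfolding invertible_def by blast
  \<comment> \<open>The error of \<open>trace_congruence_ge\<close> as a function of the derivative
    matrix. It vanishes at the identity because \<open>T\<close> is the identity there, so by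
    continuity the factor \<open>1 - f (A n)\<close> tends to 1.\<close>
  define f where "f B = (let T = msqrt G ** B ** S' in
      \<Sum>i\<in>UNIV. \<Sum>j\<in>UNIV. \<bar>(transpose T ** T - mat 1) $ i $ j\<bar>)" for B
  have f_cont: "isCont f (mat 1)"
    unfolding f_def[abs_def] Let_def
    by (simp add: matrix_matrix_mult_def transpose_def)
  have "f (mat 1) = 0" by (simp add: f_def S' transpose_mat)
  then have f: "(\<lambda>n. f (A n)) \<longlonglongrightarrow> 0" using isCont_tendsto_compose[OF f_cont A] by simp
  \<comment> \<open>Continuity of the determinant makes the derivative matrices invertible from some
    \<open>n\<close> on.\<close>
  have "isCont det (mat 1 :: real^'d^'d)"
    unfolding det_def[abs_def] by (intro continuous_intros)
  from isCont_tendsto_compose[OF this A] have "(\<lambda>n. det (A n)) \<longlonglongrightarrow> 1" by simp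
  then have ev_inv: "\<forall>\<^sub>F n in sequentially. det (A n) \<noteq> 0"
    using tendsto_imp_eventually_ne[of _ "1::real" sequentially 0] by simp
  have ev_small: "\<forall>\<^sub>F n in sequentially. f (A n) < 1"
    using order_tendstoD(2)[OF f, of 1] by simp
  have ev: "\<forall>\<^sub>F n in sequentially. ereal ((1 - f (A n)) * holevo_bound N \<rho> t G)
      \<le> ereal (real n * trace (G ** V_n N \<rho> Ms n t))"
    using ev_inv ev_small eventually_gt_at_top[of 0]
  proof eventually_elim
    case (elim n)
    then show ?case
      using holevo_bound_le_scaled_mse[OF model t G est, of n S' "msqrt G ** A n ** S'"] S'
      by (simp add: f_def Let_def A_def invertible_det_nz)
  qed
  have "(\<lambda>n. ereal ((1 - f (A n)) * holevo_bound N \<rho> t G)) \<longlonglongrightarrow> ereal ((1 - 0) * holevo_bound N \<rho> t G)"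
    by (intro tendsto_ereal tendsto_mult tendsto_diff tendsto_const f)
  from lim_imp_Liminf[OF sequentially_bot this]
  have "liminf (\<lambda>n. ereal ((1 - f (A n)) * holevo_bound N \<rho> t G)) = ereal (holevo_bound N \<rho> t G)"
    by simp
  then show ?thesis using Liminf_mono[OF ev] by simp
qed

theorem mainTheorem5:
  fixes N :: nat and \<Theta> :: "(real^'d::finite) set" and \<rho> :: "real^'d \<Rightarrow> cmat"
    and t :: "real^'d" and G :: "real^'d^'d" and Ms :: "nat \<Rightarrow> (real^'d) set \<Rightarrow> cmat"
  assumes "qmodel N \<Theta> \<rho>" and "t \<in> \<Theta>" and "weight_matrix G"
    and "estimator_seq N \<Theta> \<rho> Ms" and "asym_unbiased N \<rho> t Ms"
  shows "liminf (\<lambda>n. ereal (real n * trace (G ** V_n N \<rho> Ms n t))) \<ge> ereal (holevo_bound N \<rho> t G)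
    \<and> qcr_bound N \<Theta> \<rho> t G \<ge> ereal (holevo_bound N \<rho> t G)"
proof
  show "liminf (\<lambda>n. ereal (real n * trace (G ** V_n N \<rho> Ms n t))) \<ge> ereal (holevo_bound N \<rho> t G)"
    by (rule holevo_bound_le_liminf[OF assms])
  show "qcr_bound N \<Theta> \<rho> t G \<ge> ereal (holevo_bound N \<rho> t G)"
    unfolding qcr_bound_def
    by (rule Inf_greatest) (auto intro: holevo_bound_le_liminf[OF assms(1-3)])
qed

end
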